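(* Let $d\ge1$, $a>0$, $b\in\mathbb{R}^d$, $\sigma=\sqrt{2a}$, $\varsigma\in(0,1]$, let $D\subset\mathbb{R}^d$ be a nonempty bounded open set and $f:\partial D\to\mathbb{R}$ a continuous function. If $v\in\partial D$ is a point at which there exists a barrier $q_v$, then $v$ is a regular point for $(D,f)$.
   Context: Notation: $d(x,G)=\inf\{\|x-y\|:y\in G\}$ with $\|\cdot\|$ the Euclidean norm; $B_r(x)$ is the open Euclidean ball. Harmonic: a function $q:D\to\mathbb{R}$ is harmonic in $D$ if it is of class $C^2$ and $a\Delta q+b\cdot\nabla q=0$ in $D$. Barrier: for $v\in\partial D$, a continuous function $q_v:\overline D\to\mathbb{R}$ is a barrier at $v$ if $q_v$ is harmonic in $D$, $q_v(v)=0$, and $q_v(x)>0$ for all $x\in\overline D\setminus\{v\}$. The process: $X^x_t=x+bt+\sigma W_t$, $t\ge0$, where $W$ is a standard $d$-dimensional Brownian motion started at $0$ on a probability space $(\Omega,\mathcal F,\mathbb P)$, with expectation $\mathbb{E}$. For $r\ge 0$ put $\tau^X(B_r(x))=\inf\{t>0:X^x_t\notin B_r(x)\}$ (so for $r=0$ this time is $0$). The sequence: for $x\in D$, $Y^x_\varsigma(1)=x$ and, for $n\ge1$, $Y^x_\varsigma(n+1)=X^{Y^x_\varsigma(n)}_{\tau^X(B_{r_n}(Y^x_\varsigma(n)))}$ with $r_n=\varsigma\, d(Y^x_\varsigma(n),\partial D)$. That is, at each step the process is started afresh at $Y^x_\varsigma(n)$, independently of the past given $Y^x_\varsigma(n)$,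 and stopped when it first leaves $B_{r_n}(Y^x_\varsigma(n))$. Thus $(Y^x_\varsigma(n))_n$ is a Markov chain whose transition law from $y\in\overline D$ is the law of $X^y_{\tau^X(B_{\varsigma d(y,\partial D)}(y))}$. This sequence converges almost surely to a random point of $\partial D$, denoted $Y^x_\varsigma(\infty)$. Regular point: $v\in\partial D$ is a regular point for $(D,f)$ if $\lim_{x\to v,\,x\in D}\mathbb{E}[f(Y^x_\varsigma(\infty))]=f(v)$. *)

theory Defs
  imports "HOL-Probability.Probability"
begin

section \<open>Brownian motion with drift and its exit from a ball\<close>

text \<open>
  The Euclidean space is an arbitrary type of class \<open>euclidean_space\<close>. The last clause says
  that \<open>W t - W s\<close> is centred Gaussian with covariance matrix \<open>t - s\<close> times the identity; the second
  parameter of \<^const>\<open>normal_density\<close> is the standard deviation.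
\<close>

definition standard_brownian_motion ::
    "'w measure \<Rightarrow> (real \<Rightarrow> 'w \<Rightarrow> 'a::euclidean_space) \<Rightarrow> bool" where
  "standard_brownian_motion M W \<longleftrightarrow>
     prob_space M \<and>
     (\<forall>t\<ge>0. W t \<in> borel_measurable M) \<and>
     (\<forall>\<omega>\<in>space M. W 0 \<omega> = 0 \<and> continuous_on {0..} (\<lambda>t. W t \<omega>)) \<and>
     (\<forall>(n::nat) (ts::nat \<Rightarrow> real). 0 \<le> ts 0 \<longrightarrow> (\<forall>i<n. ts i \<le> ts (Suc i)) \<longrightarrow>
        prob_space.indep_vars M (\<lambda>_. borel) (\<lambda>i \<omega>. W (ts (Suc i)) \<omega> - W (ts i) \<omega>) {..<n}) \<and>
     (\<forall>s t. 0 \<le> s \<longrightarrow> s < t \<longrightarrow>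
        distributed M lborel (\<lambda>\<omega>. W t \<omega> - W s \<omega>)
          (\<lambda>z. ennreal (\<Prod>i\<in>Basis. normal_density 0 (sqrt (t - s)) (z \<bullet> i))))"

definition drift_process ::
    "'a::euclidean_space \<Rightarrow> real \<Rightarrow> (real \<Rightarrow> 'w \<Rightarrow> 'a) \<Rightarrow> 'a \<Rightarrow> real \<Rightarrow> 'w \<Rightarrow> 'a" where
  "drift_process b \<sigma> W x t \<omega> = x + t *\<^sub>R b + \<sigma> *\<^sub>R W t \<omega>"

definition exit_time ::
    "'a::euclidean_space \<Rightarrow> real \<Rightarrow> (real \<Rightarrow> 'w \<Rightarrow> 'a) \<Rightarrow> 'a \<Rightarrow> real \<Rightarrow> 'w \<Rightarrow> ereal" where
  "exit_time b \<sigma> W x r \<omega> = Inf {ereal t |t. 0 < t \<and> drift_process b \<sigma> W x t \<omega> \<notin> ball x r}"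

text \<open>
  On the null event that the path never leaves the ball, the exit time is \<open>\<infinity>\<close>; since
  \<open>real_of_ereal \<infinity> = 0\<close>, the exit point is then set to the starting point, which keeps it measurable.
\<close>

definition exit_point ::
    "'a::euclidean_space \<Rightarrow> real \<Rightarrow> (real \<Rightarrow> 'w \<Rightarrow> 'a) \<Rightarrow> 'a \<Rightarrow> real \<Rightarrow> 'w \<Rightarrow> 'a" where
  "exit_point b \<sigma> W x r \<omega> = drift_process b \<sigma> W x (real_of_ereal (exit_time b \<sigma> W x r \<omega>)) \<omega>"

definition transition_law ::
    "'w measure \<Rightarrow> 'a::euclidean_space \<Rightarrow> real \<Rightarrow> (real \<Rightarrow> 'w \<Rightarrow> 'a) \<Rightarrow> real \<Rightarrow> 'a set \<Rightarrow> 'a \<Rightarrow> 'a measure"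
  where
  "transition_law M b \<sigma> W \<theta> D y =
     distr M borel (exit_point b \<sigma> W y (\<theta> * infdist y (frontier D)))"


section \<open>The chain and its limit\<close>

text \<open>
  The conditional expectation is taken given the sigma-algebra generated by \<open>Y 0, \<dots>, Y n\<close>.
  Chains are indexed from \<open>0\<close>, so the starting point is \<open>Y 0\<close>.
\<close>

definition markov_chain_from ::
    "'w measure \<Rightarrow> ('a::euclidean_space \<Rightarrow> 'a measure) \<Rightarrow> 'a \<Rightarrow> (nat \<Rightarrow> 'w \<Rightarrow> 'a) \<Rightarrow> bool" where
  "markov_chain_from M K x Y \<longleftrightarrow>
     (\<forall>n. Y n \<in> borel_measurable M) \<and>
     (\<forall>\<omega>\<in>space M. Y 0 \<omega> = x) \<and>
     (\<forall>n. \<forall>A\<in>sets borel. AE \<omega> in M.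
        real_cond_exp M
          (vimage_algebra (space M) (\<lambda>\<omega>. \<lambda>i\<in>{..n}. Y i \<omega>) (\<Pi>\<^sub>M i\<in>{..n}. borel))
          (\<lambda>\<omega>. indicat_real A (Y (Suc n) \<omega>)) \<omega>
        = measure (K (Y n \<omega>)) A)"

text \<open>
  The expectation of \<open>f\<close> at the limit of the chain. The chains of interest converge almost surely to
  a point of the boundary; on the exceptional null event, where \<open>f\<close> at the limit has no meaning,
  the integrand is set to \<open>0\<close>.
\<close>

definition limit_expectation ::
    "'w measure \<Rightarrow> 'a::euclidean_space set \<Rightarrow> ('a \<Rightarrow> real) \<Rightarrow> (nat \<Rightarrow> 'w \<Rightarrow> 'a) \<Rightarrow> real" where
  "limit_expectation M D f Y =
     (LINT \<omega>|M. (if convergent (\<lambda>n. Y n \<omega>) \<and> lim (\<lambda>n. Y n \<omega>) \<in> frontier D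
                then f (lim (\<lambda>n. Y n \<omega>)) else 0))"

text \<open>\<open>Y x\<close> is the chain started at \<open>x\<close>.\<close>

definition regular_point ::
    "'w measure \<Rightarrow> ('a::euclidean_space \<Rightarrow> nat \<Rightarrow> 'w \<Rightarrow> 'a) \<Rightarrow> 'a set \<Rightarrow> ('a \<Rightarrow> real) \<Rightarrow> 'a \<Rightarrow> bool" where
  "regular_point M Y D f v \<longleftrightarrow>
     v \<in> frontier D \<and> ((\<lambda>x. limit_expectation M D f (Y x)) \<longlongrightarrow> f v) (at v within D)"


section \<open>Harmonic functions and barriers\<close>

text \<open>\<open>q\<close> is of class \<open>C\<^sup>2\<close> on the open set \<open>D\<close>, with gradient \<open>g\<close> and Hessian \<open>H\<close>.\<close>

definition C2_on ::
    "'a::euclidean_space set \<Rightarrow> ('a \<Rightarrow> real) \<Rightarrow> ('a \<Rightarrow> 'a) \<Rightarrow> ('a \<Rightarrow> 'a \<Rightarrow>\<^sub>L 'a) \<Rightarrow> bool" where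
  "C2_on D q g H \<longleftrightarrow>
     (\<forall>x\<in>D. GDERIV q x :> g x) \<and>
     (\<forall>x\<in>D. (g has_derivative blinfun_apply (H x)) (at x)) \<and>
     continuous_on D H"

text \<open>The Laplacian is the trace of the Hessian.\<close>

definition harmonic_in ::
    "real \<Rightarrow> 'a::euclidean_space \<Rightarrow> 'a set \<Rightarrow> ('a \<Rightarrow> real) \<Rightarrow> bool" where
  "harmonic_in a b D q \<longleftrightarrow>
     (\<exists>g H. C2_on D q g H \<and>
        (\<forall>x\<in>D. a * (\<Sum>i\<in>Basis. blinfun_apply (H x) i \<bullet> i) + b \<bullet> g x = 0))"

definition barrier_at ::
    "real \<Rightarrow> 'a::euclidean_space \<Rightarrow> 'a set \<Rightarrow> 'a \<Rightarrow> ('a \<Rightarrow> real) \<Rightarrow> bool" where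
  "barrier_at a b D v q \<longleftrightarrow>
     continuous_on (closure D) q \<and> harmonic_in a b D q \<and>
     q v = 0 \<and> (\<forall>x\<in>closure D - {v}. 0 < q x)"

end

theory Submission
  imports Defs
begin

text \<open>
  Dynkin's formula is replaced by an inequality for exits from balls: if \<open>h\<close> is continuous and
  \<open>a \<Delta>h + b \<bullet> \<nabla>h \<le> 0\<close> in a ball, then the mean of \<open>h\<close> at the exit point is at most the value of \<open>h\<close> at
  the centre. By Taylor's formula a Gaussian step of length \<open>\<delta>\<close> in time raises the mean of \<open>h\<close> by
  at most \<open>o(\<delta>)\<close>, uniformly on smaller balls, so the inequality holds up to \<open>o(1)\<close> for the walk on a
  grid stopped on leaving a smaller ball; refine the grid first, then let the radius grow.

  Consequently \<open>exp (k x\<^sub>i)\<close> is a bounded submartingale along the chain for every coordinate \<open>i\<close> and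
  large \<open>k\<close>, hence the chain converges almost surely, and its limit lies on the boundary because no
  small neighbourhood of a point of \<open>D\<close> contains two consecutive positions. Finally the barrier \<open>q\<close>
  satisfies \<open>\<bar>f w - f v\<bar> \<le> \<epsilon> + C q w\<close> on the boundary, and the mean of \<open>q\<close> at the limit of the chain
  started at \<open>x\<close> is at most \<open>q x\<close>, which tends to \<open>0\<close> as \<open>x\<close> tends to \<open>v\<close>.
\<close>

section \<open>Gaussian increments\<close>

text \<open>Brownian motion enters only through its continuous paths and its independent Gaussian
  increments along a time grid, so every mean-value inequality starts from a walk with finitely many
  steps. One-sided inequalities suffice because both applications point the same way: the barrier
  satisfies the equation, the negated exponentials satisfy it with \<open>\<le>\<close>. The
  obstacle is overshoot. A Gaussian step can land far outside the ball, where \<open>h\<close> obeys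
  no differential inequality and the barrier is not even defined. Hence functions are extended to
  bounded continuous functions on the whole space, and long jumps are paid for by the fourth moment
  of the step, which is of order \<open>\<delta>\<^sup>2\<close>. Exponentials suit the convergence
  argument, which asks that both the process and its square be submartingales: the square of
  \<open>exp (k * x)\<close> is again such an exponential, with \<open>2 * k\<close> for
  \<open>k\<close>, so the same computation covers both. Along the chain, conditional expectations
  are tested against bounded nonnegative functions of the past, so only plain integrals have to be
  compared.\<close>

abbreviation gaussian_density :: "real \<Rightarrow> 'a::euclidean_space \<Rightarrow> real" where
  "gaussian_density t z \<equiv> (\<Prod>i\<in>Basis. normal_density 0 (sqrt t) (z \<bullet> i))"

text \<open>Lebesgue measure is the image of the product over \<open>Basis\<close> of
  one-dimensional Lebesgue measures and the density is a product, so Fubini factors every mixed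
  moment.\<close>

lemma gaussian_coordinate_moment:
  fixes G :: "'w \<Rightarrow> 'a::euclidean_space" and m :: "'a \<Rightarrow> nat"
  assumes G: "distributed M lborel G (\<lambda>z. ennreal (gaussian_density t z))" and t: "0 < t"
  shows "has_bochner_integral M (\<lambda>\<omega>. \<Prod>k\<in>Basis. (G \<omega> \<bullet> k) ^ m k)
    (\<Prod>k\<in>(Basis::'a set). \<integral>x. normal_density 0 (sqrt t) x * x ^ m k \<partial>lborel)"
proof -
  interpret P: product_sigma_finite "\<lambda>_::'a. lborel :: real measure" by standard
  define \<phi> where "\<phi> = (\<lambda>k::'a. \<lambda>x. normal_density 0 (sqrt t) x * x ^ m k)"
  have int1: "integrable lborel (\<phi> k)" for k
    using integrable_normal_moment[of "sqrt t" 0 "m k"] t by (simp add: \<phi>_def)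
  have eq: "(\<Prod>k\<in>Basis. \<phi> k ((\<Sum>b\<in>Basis. f b *\<^sub>R b) \<bullet> k)) = (\<Prod>k\<in>Basis. \<phi> k (f k))" for f :: "'a \<Rightarrow> real"
    by (intro prod.cong refl arg_cong[where f="\<phi> _"]) (simp add: inner_sum_left inner_Basis if_distrib sum.delta cong: if_cong)
  have \<phi>m[measurable]: "\<phi> k \<in> borel_measurable borel" for k by (simp add: \<phi>_def)
  have i: "integrable lborel (\<lambda>z::'a. \<Prod>k\<in>Basis. \<phi> k (z \<bullet> k))"
    unfolding lborel_eq[where 'a='a]
    by (subst integrable_distr_eq) (auto simp: eq intro!: P.product_integrable_prod int1)
  have v: "(\<integral>z. (\<Prod>k\<in>Basis. \<phi> k ((z::'a) \<bullet> k)) \<partial>lborel) = (\<Prod>k\<in>(Basis::'a set). integral\<^sup>L lborel (\<phi> k))"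
    unfolding lborel_eq[where 'a='a]
    by (subst integral_distr) (auto simp: eq intro!: P.product_integral_prod int1)
  have dens: "(\<Prod>k\<in>Basis. \<phi> k (z \<bullet> k)) = gaussian_density t z * (\<Prod>k\<in>Basis. (z \<bullet> k) ^ m k)" for z :: 'a
    by (simp add: \<phi>_def prod.distrib)
  have nn: "0 \<le> gaussian_density t z" for z :: 'a by (intro prod_nonneg) simp
  have "integrable M (\<lambda>\<omega>. \<Prod>k\<in>Basis. (G \<omega> \<bullet> k) ^ m k)"
    using distributed_integrable[OF G, of "\<lambda>z. \<Prod>k\<in>Basis. (z \<bullet> k) ^ m k"] i nn by (simp add: dens)
  moreover have "(\<integral>\<omega>. (\<Prod>k\<in>Basis. (G \<omega> \<bullet> k) ^ m k) \<partial>M) = (\<Prod>k\<in>(Basis::'a set). integral\<^sup>L lborel (\<phi> k))"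
    using distributed_integral[OF G, of "\<lambda>z. \<Prod>k\<in>Basis. (z \<bullet> k) ^ m k"] v nn by (simp add: dens)
  ultimately show ?thesis
    by (simp add: has_bochner_integral_iff \<phi>_def)
qed

lemma normal_density_moments:
  fixes t :: real assumes t: "0 < t"
  shows "(\<integral>x. normal_density 0 (sqrt t) x * x ^ 0 \<partial>lborel) = 1"
    "(\<integral>x. normal_density 0 (sqrt t) x * x ^ 1 \<partial>lborel) = 0"
    "(\<integral>x. normal_density 0 (sqrt t) x * x ^ 2 \<partial>lborel) = t"
    "(\<integral>x. normal_density 0 (sqrt t) x * x ^ 4 \<partial>lborel) = 3 * t\<^sup>2"
  using integral_normal_moment_even[of "sqrt t" 0 0] integral_normal_moment_odd[of "sqrt t" 0 0]
    integral_normal_moment_even[of "sqrt t" 0 1] integral_normal_moment_even[of "sqrt t" 0 2] t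
  by (simp_all add: fact_numeral power2_eq_square field_simps)

lemma gaussian_moments:
  fixes G :: "'w \<Rightarrow> 'a::euclidean_space"
  assumes G: "distributed M lborel G (\<lambda>z. ennreal (gaussian_density t z))" and t: "0 < t"
    and i: "i \<in> Basis" and j: "j \<in> Basis"
  shows "has_bochner_integral M (\<lambda>\<omega>. G \<omega> \<bullet> i) 0"
    and "has_bochner_integral M (\<lambda>\<omega>. (G \<omega> \<bullet> i) * (G \<omega> \<bullet> j)) (if i = j then t else 0)"
    and "has_bochner_integral M (\<lambda>\<omega>. (G \<omega> \<bullet> i) ^ 4) (3 * t\<^sup>2)"
proof -
  note mom = normal_density_moments[OF t]
  have pick: "(\<Prod>k\<in>Basis. (x \<bullet> k) ^ (if k = i then n else 0)) = (x \<bullet> i) ^ n" for x :: 'a and n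
    using i by (subst prod.cong[OF refl, of _ _ "\<lambda>k. if k = i then (x \<bullet> i) ^ n else 1"]) auto
  have val: "(\<Prod>k\<in>(Basis::'a set). \<integral>x. normal_density 0 (sqrt t) x * x ^ (if k = i then n else 0) \<partial>lborel)
      = (\<integral>x. normal_density 0 (sqrt t) x * x ^ n \<partial>lborel)" for n
    using i mom(1) by (subst prod.cong[OF refl, of _ _ "\<lambda>k. if k = i then (\<integral>x. normal_density 0 (sqrt t) x * x ^ n \<partial>lborel) else 1"]) auto
  note single = gaussian_coordinate_moment[OF G t, of "\<lambda>k. if k = i then n else 0" for n, unfolded pick val]
  show "has_bochner_integral M (\<lambda>\<omega>. G \<omega> \<bullet> i) 0"
    using single[of 1] mom(2) by simp
  show "has_bochner_integral M (\<lambda>\<omega>. (G \<omega> \<bullet> i) ^ 4) (3 * t\<^sup>2)"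
    using single[of 4] mom(4) by simp
  show "has_bochner_integral M (\<lambda>\<omega>. (G \<omega> \<bullet> i) * (G \<omega> \<bullet> j)) (if i = j then t else 0)"
  proof (cases "i = j")
    case True
    then show ?thesis using single[of 2] mom(3) by (simp add: power2_eq_square)
  next
    case False
    \<comment> \<open>Exponent one at both \<open>i\<close> and \<open>j\<close>: the factor at
      \<open>i\<close> is a first moment and annihilates the product.\<close>
    define m where "m = (\<lambda>k. if k = i \<or> k = j then 1 else 0 :: nat)"
    have B: "Basis = insert i (insert j (Basis - {i, j}))" using i j by auto
    have "(\<Prod>k\<in>Basis. (x \<bullet> k) ^ m k) = (x \<bullet> i) * (x \<bullet> j)" for x :: 'a
      using False by (subst B) (auto simp: m_def prod.neutral)
    moreover have "(\<Prod>k\<in>(Basis::'a set). \<integral>x. normal_density 0 (sqrt t) x * x ^ m k \<partial>lborel) = 0"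
      using i mom(2) by (intro prod_zero) (auto simp: m_def intro!: bexI[of _ i])
    ultimately show ?thesis
      using gaussian_coordinate_moment[OF G t, of m] False by (simp del: prod_zero_iff)
  qed
qed

lemma has_bochner_integral_gaussian_linear:
  fixes G :: "'w \<Rightarrow> 'a::euclidean_space"
  assumes G: "distributed M lborel G (\<lambda>z. ennreal (gaussian_density t z))" and t: "0 < t"
  shows "has_bochner_integral M (\<lambda>\<omega>. c \<bullet> G \<omega>) 0"
proof -
  have "has_bochner_integral M (\<lambda>\<omega>. \<Sum>i\<in>Basis. (c \<bullet> i) * (G \<omega> \<bullet> i)) (\<Sum>i\<in>(Basis::'a set). (c \<bullet> i) * 0)"
    by (intro has_bochner_integral_sum has_bochner_integral_mult_right gaussian_moments(1)[OF G t])
  then show ?thesis by (simp flip: euclidean_inner)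
qed

lemma has_bochner_integral_gaussian_quadratic:
  fixes G :: "'w \<Rightarrow> 'a::euclidean_space"
  assumes G: "distributed M lborel G (\<lambda>z. ennreal (gaussian_density t z))" and t: "0 < t"
    and L: "linear L"
  shows "has_bochner_integral M (\<lambda>\<omega>. L (G \<omega>) \<bullet> G \<omega>) (t * (\<Sum>i\<in>Basis. L i \<bullet> i))"
proof -
  have "L x \<bullet> x = (\<Sum>j\<in>Basis. \<Sum>i\<in>Basis. (L j \<bullet> i) * ((x \<bullet> j) * (x \<bullet> i)))" for x
  proof -
    have "L x = (\<Sum>j\<in>Basis. (x \<bullet> j) *\<^sub>R L j)"
      using L linear_sum[OF L, of "\<lambda>j. (x \<bullet> j) *\<^sub>R j" Basis] by (simp add: euclidean_representation linear_scale)
    then show ?thesis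
      by (simp add: inner_sum_left euclidean_inner[of "L _" x] sum_distrib_left mult_ac)
  qed
  moreover have "has_bochner_integral M (\<lambda>\<omega>. \<Sum>j\<in>Basis. \<Sum>i\<in>Basis. (L j \<bullet> i) * ((G \<omega> \<bullet> j) * (G \<omega> \<bullet> i)))
     (\<Sum>j\<in>Basis. \<Sum>i\<in>Basis. (L j \<bullet> i) * (if j = i then t else 0))"
    by (intro has_bochner_integral_sum has_bochner_integral_mult_right gaussian_moments(2)[OF G t])
  moreover have "(\<Sum>j\<in>Basis. \<Sum>i\<in>Basis. (L j \<bullet> i) * (if j = i then t else 0)) = t * (\<Sum>i\<in>Basis. L i \<bullet> i)"
    by (simp add: if_distrib sum.delta sum_distrib_left mult_ac cong: if_cong)
  ultimately show ?thesis by simp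
qed

text \<open>The two cross terms are linear in \<open>G\<close>, gathered through the adjoint of
  \<open>L\<close> into one functional of mean zero. Taking \<open>L\<close> to be the Hessian
  produces the Laplacian; taking the identity gives the mean squared length of a step.\<close>

lemma has_bochner_integral_drifted_quadratic:
  fixes G :: "'w \<Rightarrow> 'a::euclidean_space"
  assumes M: "prob_space M" and G: "distributed M lborel G (\<lambda>z. ennreal (gaussian_density t z))" and t: "0 < t"
    and L: "linear L"
  shows "has_bochner_integral M (\<lambda>\<omega>. L (c + \<sigma> *\<^sub>R G \<omega>) \<bullet> (c + \<sigma> *\<^sub>R G \<omega>))
    (L c \<bullet> c + \<sigma>\<^sup>2 * t * (\<Sum>i\<in>Basis. L i \<bullet> i))"
proof -
  interpret prob_space M by fact
  have one: "has_bochner_integral M (\<lambda>_. k::real) k" for k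
    by (simp add: has_bochner_integral_iff prob_space)
  have "has_bochner_integral M (\<lambda>\<omega>. L c \<bullet> c + \<sigma> * ((L c + adjoint L c) \<bullet> G \<omega>) + \<sigma>\<^sup>2 * (L (G \<omega>) \<bullet> G \<omega>))
     (L c \<bullet> c + \<sigma> * 0 + \<sigma>\<^sup>2 * (t * (\<Sum>i\<in>Basis. L i \<bullet> i)))"
    by (intro has_bochner_integral_add has_bochner_integral_mult_right one
        has_bochner_integral_gaussian_linear[OF G t] has_bochner_integral_gaussian_quadratic[OF G t L])
  moreover have "L (c + \<sigma> *\<^sub>R x) \<bullet> (c + \<sigma> *\<^sub>R x) = L c \<bullet> c + \<sigma> * ((L c + adjoint L c) \<bullet> x) + \<sigma>\<^sup>2 * (L x \<bullet> x)" for x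
    using adjoint_works[OF L, of c x] adjoint_works[OF L, of x c]
    by (simp add: linear_add[OF L] linear_scale[OF L] inner_simps power2_eq_square algebra_simps inner_commute)
  ultimately show ?thesis by (simp add: mult_ac)
qed

section \<open>Taylor expansion and the mean of a supersolution after one Gaussian step\<close>

lemma norm_power4_le_sum:
  fixes x :: "'a::euclidean_space"
  shows "norm x ^ 4 \<le> DIM('a) * (\<Sum>i\<in>Basis. (x \<bullet> i) ^ 4)"
proof -
  have "norm x ^ 4 = (\<Sum>i\<in>Basis. (x \<bullet> i)\<^sup>2)\<^sup>2"
  proof -
    have "norm x ^ 4 = ((norm x)\<^sup>2)\<^sup>2" by (simp flip: power_mult)
    then show ?thesis unfolding power2_norm_eq_inner by (simp add: euclidean_inner[of x x] power2_eq_square)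
  qed
  also have "\<dots> \<le> (\<Sum>i\<in>Basis. ((x \<bullet> i)\<^sup>2)\<^sup>2) * card (Basis :: 'a set)"
    by (rule sum_squared_le_sum_of_squares)
  finally show ?thesis by (simp add: mult.commute flip: power_mult)
qed

lemma power4_norm_add_le:
  fixes x y :: "'a::real_normed_vector"
  shows "norm (x + y) ^ 4 \<le> 8 * (norm x ^ 4 + norm y ^ 4)"
proof -
  have sq: "(p + q)\<^sup>2 \<le> 2 * (p\<^sup>2 + q\<^sup>2)" for p q :: real
    using sum_squares_ge_zero[of "p - q" 0] by (simp add: power2_eq_square algebra_simps)
  have "norm (x + y) ^ 4 \<le> (norm x + norm y) ^ 4"
    by (intro power_mono norm_triangle_ineq) simp
  also have "\<dots> = ((norm x + norm y)\<^sup>2)\<^sup>2" by (simp flip: power_mult)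
  also have "\<dots> \<le> (2 * ((norm x)\<^sup>2 + (norm y)\<^sup>2))\<^sup>2"
    by (intro power_mono sq) simp
  also have "\<dots> = 4 * ((norm x)\<^sup>2 + (norm y)\<^sup>2)\<^sup>2" by (simp only: power_mult_distrib) simp
  also have "\<dots> \<le> 4 * (2 * (((norm x)\<^sup>2)\<^sup>2 + ((norm y)\<^sup>2)\<^sup>2))"
    by (intro mult_left_mono sq) simp
  finally show ?thesis by (simp flip: power_mult)
qed

text \<open>The second-order remainder along a segment is a difference of Hessians, and the Hessian
  is uniformly continuous on compact balls; hence one \<open>\<rho>\<close> serves all base points
  \<open>z\<close>.\<close>

lemma C2_taylor_remainder:
  fixes y :: "'a::euclidean_space"
  assumes C2: "C2_on (ball y r) h g H" and s: "s < r" and \<eta>: "0 < \<eta>"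
  obtains \<rho> where "0 < \<rho>"
    "\<And>z v. z \<in> ball y s \<Longrightarrow> norm v \<le> \<rho> \<Longrightarrow>
       \<bar>h (z + v) - h z - g z \<bullet> v - (blinfun_apply (H z) v \<bullet> v) / 2\<bar> \<le> \<eta> * (norm v)\<^sup>2"
proof -
  \<comment> \<open>An intermediate radius: segments of length at most \<open>s' - s\<close>
    starting in \<open>ball y s\<close> stay in a compact ball inside
    \<open>ball y r\<close>.\<close>
  define s' where "s' = (s + r) / 2"
  have s': "s < s'" "s' < r" using s by (auto simp: s'_def)
  have sub: "cball y s' \<subseteq> ball y r" using s' by auto
  have "uniformly_continuous_on (cball y s') H"
    using C2 sub by (intro compact_uniformly_continuous) (auto simp: C2_on_def intro: continuous_on_subset)
  then obtain d where d: "d > 0" "\<And>z w. z \<in> cball y s' \<Longrightarrow> w \<in> cball y s' \<Longrightarrow> dist w z < d \<Longrightarrow> dist (H w) (H z) < \<eta>"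
    unfolding uniformly_continuous_on_def using \<eta> by metis
  define \<rho> where "\<rho> = min (d / 2) (s' - s)"
  show thesis
  proof (rule that)
    show "0 < \<rho>" using d(1) s' by (simp add: \<rho>_def)
    fix z v :: 'a assume z: "z \<in> ball y s" and v: "norm v \<le> \<rho>"
    have seg: "z + t *\<^sub>R v \<in> cball y s'" "dist (z + t *\<^sub>R v) z < d" if "0 \<le> t" "t \<le> 1" for t
    proof -
      have "norm (t *\<^sub>R v) \<le> norm v" using that by (simp add: mult_left_le_one_le)
      then have n: "norm (t *\<^sub>R v) \<le> \<rho>" using v by simp
      have "dist y (z + t *\<^sub>R v) \<le> dist y z + norm (t *\<^sub>R v)"
        using dist_triangle[of y "z + t *\<^sub>R v" z] by (simp add: dist_norm)
      then show "z + t *\<^sub>R v \<in> cball y s'" using n z by (auto simp: \<rho>_def)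
      show "dist (z + t *\<^sub>R v) z < d" using n d(1) unfolding \<rho>_def by (simp add: dist_norm)
    qed
    have inD: "z + t *\<^sub>R v \<in> ball y r" if "0 \<le> t" "t \<le> 1" for t using seg(1)[OF that] sub by blast
    \<comment> \<open>The restriction of \<open>h\<close> to the segment together with its first two
      derivatives, in the indexed form that Taylor's theorem expects.\<close>
    define \<phi> where "\<phi> = (\<lambda>(m::nat) t. if m = 0 then h (z + t *\<^sub>R v) else if m = 1 then g (z + t *\<^sub>R v) \<bullet> v
        else blinfun_apply (H (z + t *\<^sub>R v)) v \<bullet> v :: real)"
    have lin: "((\<lambda>t. z + t *\<^sub>R v) has_derivative (\<lambda>t. t *\<^sub>R v)) (at t)" for t
      by (auto intro!: derivative_eq_intros)
    have d0: "DERIV (\<phi> 0) t :> \<phi> 1 t" if "0 \<le> t" "t \<le> 1" for t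
    proof -
      have "(h has_derivative (\<lambda>k. k \<bullet> g (z + t *\<^sub>R v))) (at (z + t *\<^sub>R v))"
        using C2 inD[OF that] by (auto simp: C2_on_def gderiv_def)
      from has_derivative_compose[OF lin this] show ?thesis
        by (simp add: \<phi>_def has_field_derivative_def inner_commute mult_commute_abs cong: if_cong)
    qed
    have d1: "DERIV (\<phi> 1) t :> \<phi> 2 t" if "0 \<le> t" "t \<le> 1" for t
    proof -
      have "(g has_derivative blinfun_apply (H (z + t *\<^sub>R v))) (at (z + t *\<^sub>R v))"
        using C2 inD[OF that] by (auto simp: C2_on_def)
      from has_derivative_inner_left[OF has_derivative_compose[OF lin this], of v] show ?thesis
        by (simp add: \<phi>_def has_field_derivative_def blinfun.scaleR_right mult_commute_abs cong: if_cong)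
    qed
    have "\<exists>t. 0 < t \<and> t < 1 \<and> \<phi> 0 1 = (\<Sum>m<2. (\<phi> m 0 / fact m) * (1 - 0)^m) + (\<phi> 2 t / fact 2) * (1 - 0)^2"
    proof (rule Taylor_up[where a=0 and f="\<phi> 0" and diff=\<phi>])
      show "\<forall>m t. m < 2 \<and> 0 \<le> t \<and> t \<le> 1 \<longrightarrow> DERIV (\<phi> m) t :> \<phi> (Suc m) t"
        using d0 d1 less_2_cases by (fastforce simp: numeral_2_eq_2)
    qed auto
    then obtain t where t: "0 < t" "t < 1" "\<phi> 0 1 = \<phi> 0 0 + \<phi> 1 0 + \<phi> 2 t / 2"
      by (auto simp: numeral_2_eq_2)
    have "\<bar>h (z + v) - h z - g z \<bullet> v - (blinfun_apply (H z) v \<bullet> v) / 2\<bar>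
        = \<bar>blinfun_apply (H (z + t *\<^sub>R v) - H z) v \<bullet> v\<bar> / 2"
      using t(3) by (simp add: \<phi>_def blinfun.diff_left inner_diff_left flip: diff_divide_distrib)
    also have "\<dots> \<le> (norm (H (z + t *\<^sub>R v) - H z) * norm v) * norm v / 2"
      by (intro divide_right_mono order_trans[OF Cauchy_Schwarz_ineq2] mult_right_mono norm_blinfun) auto
    also have "\<dots> \<le> (norm (H (z + t *\<^sub>R v) - H z) * norm v) * norm v" by simp
    also have "\<dots> \<le> (\<eta> * norm v) * norm v"
    proof (intro mult_right_mono)
      have "z + t *\<^sub>R v \<in> cball y s'" "z \<in> cball y s'" "dist (z + t *\<^sub>R v) z < d"
        using seg[of t] seg(1)[of 0] t by auto
      from d(2)[OF this(2,1,3)] show "norm (H (z + t *\<^sub>R v) - H z) \<le> \<eta>"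
        by (simp add: dist_norm)
    qed auto
    finally show "\<bar>h (z + v) - h z - g z \<bullet> v - (blinfun_apply (H z) v \<bullet> v) / 2\<bar> \<le> \<eta> * (norm v)\<^sup>2"
      by (simp add: power2_eq_square mult.assoc)
  qed
qed


lemma C2_on_bounded_derivatives:
  fixes y :: "'a::euclidean_space"
  assumes C2: "C2_on (ball y r) h g H" and s: "s < r"
  obtains K where "0 \<le> K" "\<And>z. z \<in> ball y s \<Longrightarrow> norm (g z) \<le> K \<and> norm (H z) \<le> K"
proof -
  have sub: "cball y s \<subseteq> ball y r" using s by auto
  have "continuous_on (ball y r) g"
  proof (rule continuous_at_imp_continuous_on, safe)
    fix x assume "x \<in> ball y r"
    then have "(g has_derivative blinfun_apply (H x)) (at x)" using C2 by (simp add: C2_on_def)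
    then show "isCont g x" by (rule has_derivative_continuous)
  qed
  moreover have "continuous_on (ball y r) H" using C2 by (simp add: C2_on_def)
  ultimately have "continuous_on (cball y s) g" "continuous_on (cball y s) H"
    using sub by (blast intro: continuous_on_subset)+
  then have "bounded (g ` cball y s)" "bounded (H ` cball y s)"
    by (auto intro!: compact_imp_bounded compact_continuous_image)
  then obtain K1 K2 where K: "\<And>z. z \<in> cball y s \<Longrightarrow> norm (g z) \<le> K1" "\<And>z. z \<in> cball y s \<Longrightarrow> norm (H z) \<le> K2"
    unfolding bounded_iff by (metis imageI)
  show thesis
    by (rule that[of "max 0 (max K1 K2)"]) (use K in \<open>auto simp: le_max_iff_disj\<close>)
qed

text \<open>Since \<open>\<sigma>\<^sup>2 = 2 * a\<close>, the mean of the drift term and of half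
  the quadratic term is \<open>t\<close> times the operator applied to \<open>h\<close>, hence
  \<open>\<le> 0\<close>, up to order \<open>t\<^sup>2\<close>. The bound \<open>\<delta>\<close> is
  fixed before \<open>z\<close> and \<open>G\<close>, so that it serves every step of a
  walk.\<close>

lemma one_step_supersolution:
  fixes y b :: "'a::euclidean_space" and a \<sigma> B :: real
  assumes a: "0 < a" "\<sigma> = sqrt (2 * a)"
    and C2: "C2_on (ball y r) h g H"
    and super: "\<And>x. x \<in> ball y r \<Longrightarrow> a * (\<Sum>i\<in>Basis. blinfun_apply (H x) i \<bullet> i) + b \<bullet> g x \<le> 0"
    and h: "h \<in> borel_measurable borel" "\<And>x. \<bar>h x\<bar> \<le> B"
    and s: "s < r" and \<eta>: "0 < \<eta>"
  obtains \<delta> where "0 < \<delta>"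
    "\<And>t z M (G :: 'w \<Rightarrow> 'a). 0 < t \<Longrightarrow> t < \<delta> \<Longrightarrow> z \<in> ball y s \<Longrightarrow> prob_space M \<Longrightarrow>
       distributed M lborel G (\<lambda>z. ennreal (gaussian_density t z)) \<Longrightarrow>
       (\<integral>\<omega>. h (z + (t *\<^sub>R b + \<sigma> *\<^sub>R G \<omega>)) \<partial>M) \<le> h z + \<eta> * t"
proof -
  define d where "d = real DIM('a)"
  have d: "0 < d" by (simp add: d_def)
  have \<sigma>2: "\<sigma>\<^sup>2 = 2 * a" using a by simp
  \<comment> \<open>The remainder \<open>\<eta>1 * (v \<bullet> v)\<close> has mean about
    \<open>\<eta>1 * 2 * a * d * t\<close>; this choice makes it \<open>\<eta> / 2\<close> per unit
    of time.\<close>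
  define \<eta>1 where "\<eta>1 = \<eta> / (2 * (2 * a) * d)"
  have \<eta>1: "0 < \<eta>1" using \<eta> a d by (simp add: \<eta>1_def)
  obtain \<rho> where \<rho>: "0 < \<rho>" "\<And>z v. z \<in> ball y s \<Longrightarrow> norm v \<le> \<rho> \<Longrightarrow>
       \<bar>h (z + v) - h z - g z \<bullet> v - (blinfun_apply (H z) v \<bullet> v) / 2\<bar> \<le> \<eta>1 * (norm v)\<^sup>2"
    using C2_taylor_remainder[OF C2 s \<eta>1] by blast
  obtain K where K: "0 \<le> K" "\<And>z. z \<in> ball y s \<Longrightarrow> norm (g z) \<le> K \<and> norm (H z) \<le> K"
    using C2_on_bounded_derivatives[OF C2 s] by blast
  have B: "0 \<le> B" using h(2)[of 0] by simp
  \<comment> \<open>For \<open>norm v > \<rho>\<close> the ratio \<open>norm v / \<rho>\<close>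
    exceeds one, so the constant, linear and quadratic terms are raised to fourth order by its
    powers 4, 3 and 2.\<close>
  define C where "C = 2 * B / \<rho> ^ 4 + K / \<rho> ^ 3 + K / \<rho> ^ 2"
  have C: "0 \<le> C" using B K \<rho> by (simp add: C_def)
  have taylor: "h (z + v) \<le> h z + g z \<bullet> v + (blinfun_apply (H z) v \<bullet> v) / 2 + \<eta>1 * (v \<bullet> v) + C * norm v ^ 4"
    if z: "z \<in> ball y s" for z v
  proof (cases "norm v \<le> \<rho>")
    case True
    then show ?thesis using \<rho>(2)[OF z True] C
      by (simp add: power2_norm_eq_inner) (smt (verit) zero_le_mult_iff zero_le_power norm_ge_zero)
  next
    case False
    define n where "n = norm v"
    have n: "\<rho> \<le> n" "0 < n" using False \<rho>(1) by (auto simp: n_def)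
    have q: "1 \<le> n / \<rho>" using n \<rho>(1) by simp
    have "h (z + v) - h z \<le> 2 * B" using h(2)[of z] h(2)[of "z + v"] by linarith
    also have "2 * B \<le> 2 * B * (n / \<rho>) ^ 4"
      using B mult_left_mono[OF one_le_power[OF q, of 4], of "2 * B"] by simp
    finally have 1: "h (z + v) - h z \<le> 2 * B / \<rho> ^ 4 * n ^ 4" by (simp add: power_divide)
    have "- (g z \<bullet> v) \<le> norm (g z) * norm v" using Cauchy_Schwarz_ineq2[of "g z" v] by linarith
    also have "\<dots> \<le> K * n" using K(2)[OF z] by (auto simp: n_def intro: mult_right_mono)
    also have "\<dots> \<le> K * n * (n / \<rho>) ^ 3"
      using K(1) n mult_left_mono[OF one_le_power[OF q, of 3], of "K * n"] by simp
    finally have 2: "- (g z \<bullet> v) \<le> K / \<rho> ^ 3 * n ^ 4" by (simp add: power_divide power4_eq_xxxx power3_eq_cube mult_ac)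
    have "- (blinfun_apply (H z) v \<bullet> v) \<le> norm (blinfun_apply (H z) v) * norm v"
      using Cauchy_Schwarz_ineq2[of "blinfun_apply (H z) v" v] by linarith
    also have "\<dots> \<le> (norm (H z) * norm v) * norm v" by (intro mult_right_mono norm_blinfun) simp
    also have "\<dots> \<le> K * n\<^sup>2" using K(2)[OF z] by (auto simp: n_def power2_eq_square mult.assoc intro!: mult_right_mono)
    also have "\<dots> \<le> K * n\<^sup>2 * (n / \<rho>) ^ 2"
      using K(1) n mult_left_mono[OF one_le_power[OF q, of 2], of "K * n\<^sup>2"] by simp
    finally have 3: "- (blinfun_apply (H z) v \<bullet> v) \<le> K / \<rho> ^ 2 * n ^ 4"
      by (simp add: power_divide power4_eq_xxxx power2_eq_square mult_ac)
    have 4: "0 \<le> K / \<rho> ^ 2 * n ^ 4" using K by simp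
    have 5: "0 \<le> \<eta>1 * (v \<bullet> v)" using \<eta>1 by simp
    have "C * n ^ 4 = 2 * B / \<rho> ^ 4 * n ^ 4 + K / \<rho> ^ 3 * n ^ 4 + K / \<rho> ^ 2 * n ^ 4"
      by (simp add: C_def distrib_right)
    then show ?thesis using 1 2 3 4 5 unfolding n_def[symmetric] by linarith
  qed
  \<comment> \<open>All contributions apart from the operator term, divided by \<open>t\<close>. At
    \<open>t = 0\<close> only \<open>\<eta>1 * 2 * a * d = \<eta> / 2\<close> survives, which leaves
    room below \<open>\<eta>\<close>.\<close>
  define err where "err = (\<lambda>t. t * (K * (norm b)\<^sup>2 / 2) + \<eta>1 * (t * (b \<bullet> b) + 2 * a * d)
      + 8 * C * (t ^ 3 * norm b ^ 4 + 3 * (2 * a)\<^sup>2 * d\<^sup>2 * t))"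
  have "(err \<longlongrightarrow> err 0) (at_right 0)"
    unfolding err_def by (intro tendsto_intros)
  moreover have "err 0 < \<eta>" using \<eta> a d by (simp add: err_def \<eta>1_def field_simps)
  ultimately have "eventually (\<lambda>t. err t < \<eta>) (at_right 0)" by (rule order_tendstoD)
  then obtain \<delta> where \<delta>: "0 < \<delta>" "\<And>t. 0 < t \<Longrightarrow> t < \<delta> \<Longrightarrow> err t < \<eta>"
    unfolding eventually_at_right[OF zero_less_one] by auto
  show thesis
  proof (rule that[OF \<delta>(1)])
    fix t z and M :: "'w measure" and G :: "'w \<Rightarrow> 'a"
    assume t: "0 < t" "t < \<delta>" and z: "z \<in> ball y s" and M: "prob_space M"
      and G: "distributed M lborel G (\<lambda>z. ennreal (gaussian_density t z))"
    interpret prob_space M by fact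
    have Gm[measurable]: "G \<in> borel_measurable M"
      using distributed_measurable[OF G] by simp
    note [measurable] = h(1)
    define V where "V = (\<lambda>\<omega>. t *\<^sub>R b + \<sigma> *\<^sub>R G \<omega>)"
    have one: "has_bochner_integral M (\<lambda>_. k::real) k" for k
      by (simp add: has_bochner_integral_iff prob_space)
    \<comment> \<open>A majorant of \<open>h (z + V \<omega>)\<close> that is polynomial in
      \<open>G\<close>, so that its mean can be computed exactly.\<close>
    define Q where "Q = (\<lambda>\<omega>. h z + (t * (g z \<bullet> b) + \<sigma> * (g z \<bullet> G \<omega>)) + (blinfun_apply (H z) (V \<omega>) \<bullet> V \<omega>) / 2
       + \<eta>1 * (V \<omega> \<bullet> V \<omega>) + C * (8 * (t ^ 4 * norm b ^ 4 + \<sigma> ^ 4 * (d * (\<Sum>i\<in>Basis. (G \<omega> \<bullet> i) ^ 4)))))"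
    have Q: "has_bochner_integral M Q (h z + (t * (g z \<bullet> b) + \<sigma> * 0)
       + (blinfun_apply (H z) (t *\<^sub>R b) \<bullet> (t *\<^sub>R b) + \<sigma>\<^sup>2 * t * (\<Sum>i\<in>Basis. blinfun_apply (H z) i \<bullet> i)) / 2
       + \<eta>1 * ((t *\<^sub>R b) \<bullet> (t *\<^sub>R b) + \<sigma>\<^sup>2 * t * (\<Sum>i\<in>(Basis::'a set). i \<bullet> i))
       + C * (8 * (t ^ 4 * norm b ^ 4 + \<sigma> ^ 4 * (d * (\<Sum>i\<in>(Basis::'a set). 3 * t\<^sup>2)))))"
      unfolding Q_def V_def
      by (intro has_bochner_integral_add has_bochner_integral_mult_right has_bochner_integral_divide one
        has_bochner_integral_gaussian_linear[OF G t(1)] has_bochner_integral_sum gaussian_moments(3)[OF G t(1)]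
        has_bochner_integral_drifted_quadratic[OF M G t(1)] bounded_linear.linear[OF blinfun.bounded_linear_right]
        has_bochner_integral_drifted_quadratic[OF M G t(1), of "\<lambda>x. x"] linear_ident)
    have le: "h (z + V \<omega>) \<le> Q \<omega>" for \<omega>
    proof -
      have "norm (V \<omega>) ^ 4 \<le> 8 * (norm (t *\<^sub>R b) ^ 4 + norm (\<sigma> *\<^sub>R G \<omega>) ^ 4)"
        unfolding V_def by (rule power4_norm_add_le)
      also have "\<dots> = 8 * (t ^ 4 * norm b ^ 4 + \<sigma> ^ 4 * norm (G \<omega>) ^ 4)"
        by (simp add: power_mult_distrib)
      also have "\<dots> \<le> 8 * (t ^ 4 * norm b ^ 4 + \<sigma> ^ 4 * (d * (\<Sum>i\<in>Basis. (G \<omega> \<bullet> i) ^ 4)))"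
        using norm_power4_le_sum[of "G \<omega>"] by (intro mult_left_mono add_left_mono) (auto simp: d_def)
      finally have "C * norm (V \<omega>) ^ 4 \<le> C * (8 * (t ^ 4 * norm b ^ 4 + \<sigma> ^ 4 * (d * (\<Sum>i\<in>Basis. (G \<omega> \<bullet> i) ^ 4))))"
        using C by (rule mult_left_mono)
      moreover have "g z \<bullet> V \<omega> = t * (g z \<bullet> b) + \<sigma> * (g z \<bullet> G \<omega>)"
        by (simp add: V_def inner_simps)
      ultimately show ?thesis using taylor[OF z, of "V \<omega>"] unfolding Q_def by linarith
    qed
    have "(\<integral>\<omega>. h (z + V \<omega>) \<partial>M) \<le> integral\<^sup>L M Q"
    proof (rule integral_mono)
      show "integrable M (\<lambda>\<omega>. h (z + V \<omega>))"
        unfolding V_def by (rule integrable_const_bound[of _ B]) (auto simp: h(2))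
    qed (use Q le in \<open>auto simp: has_bochner_integral_iff\<close>)
    also have "\<dots> = h z + t * (a * (\<Sum>i\<in>Basis. blinfun_apply (H z) i \<bullet> i) + b \<bullet> g z)
       + t\<^sup>2 * (blinfun_apply (H z) b \<bullet> b) / 2 + \<eta>1 * (t\<^sup>2 * (b \<bullet> b) + 2 * a * t * d)
       + C * (8 * (t ^ 4 * norm b ^ 4 + (2 * a)\<^sup>2 * (d * (d * (3 * t\<^sup>2)))))"
    proof -
      have s4: "\<sigma> ^ 4 = (2 * a)\<^sup>2" unfolding \<sigma>2[symmetric] by (simp flip: power_mult)
      show ?thesis
        unfolding has_bochner_integral_integral_eq[OF Q] s4 \<sigma>2
        by (simp add: blinfun.scaleR_right power2_eq_square d_def inner_commute[of "g z"] algebra_simps add_divide_distrib)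
    qed
    also have "\<dots> \<le> h z + t * 0 + t\<^sup>2 * (K * (norm b)\<^sup>2) / 2 + \<eta>1 * (t\<^sup>2 * (b \<bullet> b) + 2 * a * t * d)
       + C * (8 * (t ^ 4 * norm b ^ 4 + (2 * a)\<^sup>2 * (d * (d * (3 * t\<^sup>2)))))"
    proof (intro add_mono order_refl mult_left_mono divide_right_mono)
      show "a * (\<Sum>i\<in>Basis. blinfun_apply (H z) i \<bullet> i) + b \<bullet> g z \<le> 0"
        using super[of z] z s by auto
      have "blinfun_apply (H z) b \<bullet> b \<le> norm (blinfun_apply (H z) b) * norm b" by (rule norm_cauchy_schwarz)
      also have "\<dots> \<le> (norm (H z) * norm b) * norm b" by (intro mult_right_mono norm_blinfun) simp
      also have "\<dots> \<le> K * (norm b)\<^sup>2"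
        using K(2)[OF z] by (auto simp: power2_eq_square mult.assoc intro!: mult_right_mono)
      finally show "blinfun_apply (H z) b \<bullet> b \<le> K * (norm b)\<^sup>2" .
    qed (use t in auto)
    also have "\<dots> = h z + err t * t"
      by (simp add: err_def algebra_simps power2_eq_square power3_eq_cube power4_eq_xxxx)
    also have "\<dots> \<le> h z + \<eta> * t" using \<delta>(2)[OF t] t(1) by simp
    finally show "(\<integral>\<omega>. h (z + (t *\<^sub>R b + \<sigma> *\<^sub>R G \<omega>)) \<partial>M) \<le> h z + \<eta> * t" by (simp add: V_def)
  qed
qed


section \<open>Stopped random walks\<close>

primrec stopped_walk :: "'a::real_normed_vector set \<Rightarrow> 'a \<Rightarrow> (nat \<Rightarrow> 'a) \<Rightarrow> nat \<Rightarrow> 'a" where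
  "stopped_walk B y x 0 = y"
| "stopped_walk B y x (Suc k) =
     (if stopped_walk B y x k \<in> B then stopped_walk B y x k + x k else stopped_walk B y x k)"

lemma stopped_walk_cong:
  "(\<And>i. i < k \<Longrightarrow> x i = x' i) \<Longrightarrow> stopped_walk B y x k = stopped_walk B y x' k"
  by (induction k) auto

lemma measurable_stopped_walk:
  fixes B :: "'a::euclidean_space set"
  assumes [measurable]: "B \<in> sets borel" and x: "\<And>i. i < k \<Longrightarrow> (\<lambda>\<omega>. x \<omega> i) \<in> borel_measurable N"
  shows "(\<lambda>\<omega>. stopped_walk B y (x \<omega>) k) \<in> borel_measurable N"
  using x
proof (induction k)
  case (Suc k)
  have [measurable]: "(\<lambda>\<omega>. stopped_walk B y (x \<omega>) k) \<in> borel_measurable N" "(\<lambda>\<omega>. x \<omega> k) \<in> borel_measurable N"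
    using Suc by auto
  show ?case by simp
qed simp

text \<open>Increments telescope until the first position outside \<open>B\<close>. This joins the
  recursive form, suited to independence, with the \<open>LEAST\<close> form, suited to exit
  times.\<close>

lemma stopped_walk_eq_path:
  fixes S :: "nat \<Rightarrow> 'a::real_normed_vector"
  shows "stopped_walk B (S 0) (\<lambda>k. S (Suc k) - S k) n = S (LEAST k. k = n \<or> S k \<notin> B)"
proof (induction n)
  case 0
  then show ?case by (simp add: Least_equality)
next
  case (Suc n)
  define N where "N = (LEAST k. k = n \<or> S k \<notin> B)"
  have N: "N = n \<or> S N \<notin> B" "\<And>k. k < N \<Longrightarrow> k \<noteq> n \<and> S k \<in> B"
    unfolding N_def using LeastI[of "\<lambda>k. k = n \<or> S k \<notin> B" n] not_less_Least by blast+
  have Nn: "N \<le> n" unfolding N_def by (rule Least_le) simp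
  show ?case
  proof (cases "S N \<in> B")
    case True
    then have "N = n" using N by simp
    have "(LEAST k. k = Suc n \<or> S k \<notin> B) = Suc n"
      using N(2) True \<open>N = n\<close> by (intro Least_equality) (metis less_antisym not_less less_Suc_eq_le)+
    then show ?thesis using True Suc \<open>N = n\<close> by (simp add: N_def[symmetric])
  next
    case False
    have "(LEAST k. k = Suc n \<or> S k \<notin> B) = N"
      using N(2) False Nn by (intro Least_equality) (auto simp: not_less[symmetric])
    then show ?thesis using False Suc by (simp add: N_def[symmetric])
  qed
qed

text \<open>Freezing: independence makes the joint law a product, so by Fubini \<open>Y\<close> can
  be averaged with \<open>X\<close> held fixed. It does the work of conditioning on
  \<open>X\<close>.\<close>

lemma (in prob_space) integral_indep_le:
  fixes X Y :: "'a \<Rightarrow> 'b" and f :: "'b \<Rightarrow> 'b \<Rightarrow> real"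
  assumes ind: "indep_var S X T Y"
    and f[measurable]: "case_prod f \<in> borel_measurable (S \<Otimes>\<^sub>M T)" and bd: "\<And>x y. \<bar>f x y\<bar> \<le> C"
    and g[measurable]: "g \<in> borel_measurable S" and gbd: "\<And>x. \<bar>g x\<bar> \<le> C'"
    and le: "\<And>x. x \<in> space S \<Longrightarrow> (\<integral>\<omega>. f x (Y \<omega>) \<partial>M) \<le> g x"
  shows "(\<integral>\<omega>. f (X \<omega>) (Y \<omega>) \<partial>M) \<le> (\<integral>\<omega>. g (X \<omega>) \<partial>M)"
proof -
  have X[measurable]: "X \<in> measurable M S" and Y[measurable]: "Y \<in> measurable M T"
    using indep_var_rv1[OF ind] indep_var_rv2[OF ind] by auto
  interpret X: prob_space "distr M S X" by (rule prob_space_distr) simp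
  interpret Y: prob_space "distr M T Y" by (rule prob_space_distr) simp
  interpret XY: pair_prob_space "distr M S X" "distr M T Y" ..
  have joint: "distr M S X \<Otimes>\<^sub>M distr M T Y = distr M (S \<Otimes>\<^sub>M T) (\<lambda>\<omega>. (X \<omega>, Y \<omega>))"
    using ind by (simp add: indep_var_distribution_eq)
  have int: "integrable (distr M S X \<Otimes>\<^sub>M distr M T Y) (case_prod f)"
    by (rule XY.P.integrable_const_bound[of _ C]) (auto simp: bd split: prod.splits)
  have "(\<integral>\<omega>. f (X \<omega>) (Y \<omega>) \<partial>M) = (\<integral>p. case_prod f p \<partial>(distr M S X \<Otimes>\<^sub>M distr M T Y))"
    unfolding joint by (subst integral_distr) auto
  also have "\<dots> = (\<integral>x. (\<integral>y. f x y \<partial>distr M T Y) \<partial>distr M S X)"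
    using XY.integral_fst[OF int] by simp
  also have "\<dots> \<le> (\<integral>x. g x \<partial>distr M S X)"
  proof (rule integral_mono)
    show "integrable (distr M S X) (\<lambda>x. \<integral>y. f x y \<partial>distr M T Y)" using XY.integrable_fst[OF int] by simp
    show "integrable (distr M S X) g" by (rule X.integrable_const_bound[of _ C']) (auto simp: gbd)
    fix x assume "x \<in> space (distr M S X)"
    then have x: "x \<in> space S" by simp
    have "(\<lambda>y. f x y) \<in> borel_measurable T" using measurable_Pair2[OF f x] by simp
    then show "(\<integral>y. f x y \<partial>distr M T Y) \<le> g x" using le[OF x] by (subst integral_distr) auto
  qed
  also have "\<dots> = (\<integral>\<omega>. g (X \<omega>) \<partial>M)" by (subst integral_distr) auto
  finally show ?thesis .
qed

text \<open>The position after \<open>k\<close> steps depends only on the increments with index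
  below \<open>k\<close>, so it is independent of increment \<open>k\<close>. A move raises the mean
  by at most \<open>c\<close>, and a frozen step by nothing.\<close>

lemma (in prob_space) stopped_walk_supersolution:
  fixes \<xi> :: "nat \<Rightarrow> 'a \<Rightarrow> 'b::euclidean_space" and h :: "'b \<Rightarrow> real" and c C :: real
  assumes ind: "indep_vars (\<lambda>_. borel) \<xi> {..<n}"
    and B[measurable]: "B \<in> sets borel"
    and h[measurable]: "h \<in> borel_measurable borel" and bd: "\<And>x. \<bar>h x\<bar> \<le> C"
    and step: "\<And>k z. k < n \<Longrightarrow> z \<in> B \<Longrightarrow> (\<integral>\<omega>. h (z + \<xi> k \<omega>) \<partial>M) \<le> h z + c" and c: "0 \<le> c"
    and k: "k \<le> n"
  shows "(\<integral>\<omega>. h (stopped_walk B y (\<lambda>i. \<xi> i \<omega>) k) \<partial>M) \<le> h y + k * c"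
  using k
proof (induction k)
  case 0
  then show ?case by (simp add: prob_space)
next
  case (Suc k)
  have \<xi>[measurable]: "\<xi> i \<in> borel_measurable M" if "i < n" for i
    using ind that by (auto simp: indep_vars_def)
  let ?Z = "\<lambda>k \<omega>. stopped_walk B y (\<lambda>i. \<xi> i \<omega>) k"
  have Z[measurable]: "?Z k \<in> borel_measurable M"
    using Suc.prems by (intro measurable_stopped_walk B) auto
  have "indep_var (PiM {..<k} (\<lambda>_. borel)) (\<lambda>\<omega>. restrict (\<lambda>i. \<xi> i \<omega>) {..<k})
      (PiM {k} (\<lambda>_. borel)) (\<lambda>\<omega>. restrict (\<lambda>i. \<xi> i \<omega>) {k})"
    using Suc.prems by (intro indep_var_restrict[OF ind]) auto
  then have "indep_var borel ((\<lambda>x. stopped_walk B y x k) \<circ> (\<lambda>\<omega>. restrict (\<lambda>i. \<xi> i \<omega>) {..<k}))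
      borel ((\<lambda>x. x k) \<circ> (\<lambda>\<omega>. restrict (\<lambda>i. \<xi> i \<omega>) {k}))"
    by (rule indep_var_compose) (auto intro!: measurable_stopped_walk[OF B] measurable_component_singleton)
  moreover have "(\<lambda>x. stopped_walk B y x k) \<circ> (\<lambda>\<omega>. restrict (\<lambda>i. \<xi> i \<omega>) {..<k}) = ?Z k"
    by (auto simp: fun_eq_iff intro!: stopped_walk_cong)
  moreover have "(\<lambda>x. x k) \<circ> (\<lambda>\<omega>. restrict (\<lambda>i. \<xi> i \<omega>) {k}) = \<xi> k" by auto
  ultimately have ind': "indep_var borel (?Z k) borel (\<xi> k)" by simp
  have "(\<integral>\<omega>. h (?Z (Suc k) \<omega>) \<partial>M) = (\<integral>\<omega>. (\<lambda>z x. h (if z \<in> B then z + x else z)) (?Z k \<omega>) (\<xi> k \<omega>) \<partial>M)"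
    by simp
  also have "\<dots> \<le> (\<integral>\<omega>. h (?Z k \<omega>) + c \<partial>M)"
  proof (rule integral_indep_le[OF ind', where f="\<lambda>z x. h (if z \<in> B then z + x else z)" and C=C and C'="C + c" and g="\<lambda>z. h z + c"])
    show "(\<lambda>(z, x). h (if z \<in> B then z + x else z)) \<in> borel_measurable (borel \<Otimes>\<^sub>M borel)"
      by measurable
    fix z show "(\<integral>\<omega>. h (if z \<in> B then z + \<xi> k \<omega> else z) \<partial>M) \<le> h z + c"
      using step[of k z] Suc.prems c by (cases "z \<in> B") (auto simp: prob_space)
    show "\<bar>h z + c\<bar> \<le> C + c" using bd[of z] c by linarith
  qed (auto simp: bd split: prod.splits)
  also have "\<dots> = (\<integral>\<omega>. h (?Z k \<omega>) \<partial>M) + c"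
    by (subst Bochner_Integration.integral_add) (auto simp: prob_space bd intro!: integrable_const_bound[of _ C])
  also have "\<dots> \<le> h y + Suc k * c"
    using Suc by (simp add: algebra_simps)
  finally show ?case .
qed


section \<open>Exit times of continuous paths\<close>

definition capped_exit :: "(real \<Rightarrow> 'a) \<Rightarrow> 'a set \<Rightarrow> real \<Rightarrow> real" where
  "capped_exit p B T = Inf (insert T {t. 0 \<le> t \<and> p t \<notin> B})"

lemma capped_exit:
  fixes p :: "real \<Rightarrow> 'a::topological_space"
  assumes p: "continuous_on {0..} p" and B: "open B" and T: "0 \<le> T"
  shows "0 \<le> capped_exit p B T" and "capped_exit p B T \<le> T"
    and "capped_exit p B T < T \<Longrightarrow> p (capped_exit p B T) \<notin> B"
    and "0 \<le> t \<Longrightarrow> t < capped_exit p B T \<Longrightarrow> p t \<in> B"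
proof -
  let ?S = "insert T {t. 0 \<le> t \<and> p t \<notin> B}"
  have "closed ({0..} \<inter> p -` (- B))"
    using p B by (intro continuous_closed_preimage) auto
  moreover have "?S = insert T ({0..} \<inter> p -` (- B))" by auto
  ultimately have cl: "closed ?S" by simp
  have bdd: "bdd_below ?S" using T by (intro bdd_belowI[of _ 0]) auto
  have mem: "capped_exit p B T \<in> ?S"
    unfolding capped_exit_def using bdd cl by (intro closed_contains_Inf) auto
  show "0 \<le> capped_exit p B T" using mem T by auto
  show "capped_exit p B T \<le> T" unfolding capped_exit_def using bdd by (intro cInf_lower) auto
  show "capped_exit p B T < T \<Longrightarrow> p (capped_exit p B T) \<notin> B" using mem by auto
  show "p t \<in> B" if "0 \<le> t" "t < capped_exit p B T"
  proof (rule ccontr)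
    assume "p t \<notin> B"
    then have "capped_exit p B T \<le> t" unfolding capped_exit_def using that bdd by (intro cInf_lower) auto
    then show False using that by simp
  qed
qed

text \<open>Dyadic grids are nested, so refinement can only make the exit earlier. The alternative
  \<open>k = 2 ^ m\<close> is the cap at time \<open>T\<close>.\<close>

definition grid_exit :: "(real \<Rightarrow> 'a) \<Rightarrow> 'a set \<Rightarrow> real \<Rightarrow> nat \<Rightarrow> real" where
  "grid_exit p B T m = real (LEAST k. k = 2 ^ m \<or> p (real k * (T / 2 ^ m)) \<notin> B) * (T / 2 ^ m)"

lemma grid_exit:
  fixes p :: "real \<Rightarrow> 'a"
  assumes T: "0 < T"
  shows "0 \<le> grid_exit p B T m" and "grid_exit p B T m \<le> T"
    and "grid_exit p B T m < T \<Longrightarrow> p (grid_exit p B T m) \<notin> B"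
    and "k \<le> 2 ^ m \<Longrightarrow> p (real k * (T / 2 ^ m)) \<notin> B \<Longrightarrow> grid_exit p B T m \<le> real k * (T / 2 ^ m)"
    and "grid_exit p B T (Suc m) \<le> grid_exit p B T m"
proof -
  define N where "N = (\<lambda>m. LEAST k. k = 2 ^ m \<or> p (real k * (T / 2 ^ m)) \<notin> B)"
  have N: "N m = 2 ^ m \<or> p (real (N m) * (T / 2 ^ m)) \<notin> B" for m
    unfolding N_def by (rule LeastI[of _ "2 ^ m"]) simp
  have Nle: "k = 2 ^ m \<or> p (real k * (T / 2 ^ m)) \<notin> B \<Longrightarrow> N m \<le> k" for m k
    unfolding N_def by (rule Least_le)
  have e: "grid_exit p B T m = real (N m) * (T / 2 ^ m)" for m
    by (simp add: grid_exit_def N_def)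
  have "N m \<le> 2 ^ m" by (rule Nle) simp
  then have "real (N m) \<le> 2 ^ m" by (metis of_nat_le_iff of_nat_numeral of_nat_power)
  then show "grid_exit p B T m \<le> T" using T by (simp add: e field_simps)
  show "0 \<le> grid_exit p B T m" using T by (simp add: e)
  show "grid_exit p B T m < T \<Longrightarrow> p (grid_exit p B T m) \<notin> B"
    using N[of m] T by (auto simp: e)
  show "grid_exit p B T m \<le> real k * (T / 2 ^ m)" if "p (real k * (T / 2 ^ m)) \<notin> B"
    unfolding e using Nle[of k m] that T by (intro mult_right_mono) auto
  have "N (Suc m) \<le> 2 * N m"
    using N[of m] by (intro Nle) (auto simp: field_simps)
  then have "real (N (Suc m)) \<le> 2 * real (N m)" by linarith
  then have "real (N (Suc m)) * (T / 2 ^ Suc m) \<le> 2 * real (N m) * (T / 2 ^ Suc m)"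
    using T by (intro mult_right_mono) auto
  then show "grid_exit p B T (Suc m) \<le> grid_exit p B T m" by (simp add: e)
qed

text \<open>
  A path may touch the sphere of radius \<open>r\<close> without leaving the closed ball, and a grid need not see
  such a contact. Looking for grid points outside a slightly smaller ball cures this: the exit times
  through finer and finer grids decrease to a time lying between the two exit times.
\<close>

lemma grid_exit_limit:
  fixes p :: "real \<Rightarrow> 'a::euclidean_space"
  assumes p: "continuous_on {0..} p" and T: "0 < T" and s: "s < r"
  obtains S where "grid_exit p (ball y s) T \<longlonglongrightarrow> S" "0 \<le> S" "S \<le> capped_exit p (ball y r) T"
    "S < T \<Longrightarrow> p S \<notin> ball y s"
proof -
  let ?e = "grid_exit p (ball y s) T" and ?U = "capped_exit p (ball y r) T"
  note e = grid_exit[OF T, where p=p and B="ball y s"]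
  have "decseq ?e" by (rule decseq_SucI) (rule e(5))
  then obtain S where S: "?e \<longlonglongrightarrow> S"
    using decseq_convergent[of ?e 0] e(1) by metis
  have S0: "0 \<le> S" using LIMSEQ_le_const[OF S] e(1) by blast
  have cont: "(\<lambda>m. p (t m)) \<longlonglongrightarrow> p l" if "t \<longlonglongrightarrow> l" "\<And>m. 0 \<le> t m" "0 \<le> l" for t l
    using continuous_on_tendsto_compose[OF p that(1)] that by auto
  note U = capped_exit[OF p open_ball[of y r] less_imp_le[OF T]]
  have "S \<le> ?U"
  proof (cases "?U < T")
    case False
    then show ?thesis using U(2) LIMSEQ_le_const2[OF S, of T] e(2) by auto
  next
    case True
    \<comment> \<open>The first grid index not before the exit time \<open>U\<close>; the
      corresponding times tend to \<open>U\<close> from above. At \<open>U\<close> the path is at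
      distance at least \<open>r > s\<close> from \<open>y\<close>, so by continuity these grid
      points eventually lie outside the smaller ball.\<close>
    define k where "k = (\<lambda>m. nat \<lceil>?U * 2 ^ m / T\<rceil>)"
    define t where "t = (\<lambda>m. real (k m) * (T / 2 ^ m))"
    have k1: "real (k m) = of_int \<lceil>?U * 2 ^ m / T\<rceil>" for m
      using U(1) T by (simp add: k_def)
    have k2: "?U * 2 ^ m / T \<le> real (k m)" "real (k m) \<le> ?U * 2 ^ m / T + 1" for m
      unfolding k1 by linarith+
    have "\<lceil>?U * 2 ^ m / T\<rceil> \<le> 2 ^ m" for m
      using U(2) T by (simp add: ceiling_le_iff field_simps)
    then have k3: "k m \<le> 2 ^ m" for m by (simp add: k_def nat_le_iff)
    have t1: "?U \<le> t m" for m
      using mult_right_mono[OF k2(1)[of m], of "T / 2 ^ m"] T by (simp add: t_def)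
    have t2: "t m \<le> ?U + T * (1 / 2) ^ m" for m
      using mult_right_mono[OF k2(2)[of m], of "T / 2 ^ m"] T by (simp add: t_def distrib_right power_one_over add_divide_distrib)
    have "(\<lambda>m. ?U + T * (1 / 2) ^ m) \<longlonglongrightarrow> ?U + T * 0"
      by (intro tendsto_intros) auto
    then have t: "t \<longlonglongrightarrow> ?U"
      by (intro tendsto_sandwich[OF _ _ tendsto_const, of ?U t]) (auto simp: t1 t2)
    have "(\<lambda>m. dist y (p (t m))) \<longlonglongrightarrow> dist y (p ?U)"
      using U(1) t1 order_trans by (intro tendsto_dist tendsto_const cont[OF t]) blast+
    moreover have "s < dist y (p ?U)" using U(3)[OF True] s by simp
    ultimately have "eventually (\<lambda>m. s < dist y (p (t m))) sequentially" by (rule order_tendstoD)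
    then have "eventually (\<lambda>m. ?e m \<le> t m) sequentially"
      by eventually_elim (use e(4) k3 in \<open>auto simp: t_def\<close>)
    then show ?thesis by (rule tendsto_le[OF sequentially_bot t S])
  qed
  moreover have "p S \<notin> ball y s" if "S < T"
  proof -
    have "eventually (\<lambda>m. ?e m < T) sequentially" using S that by (rule order_tendstoD)
    then have "eventually (\<lambda>m. s \<le> dist y (p (?e m))) sequentially"
      by eventually_elim (use e(3) in \<open>force simp: not_less\<close>)
    moreover have "(\<lambda>m. dist y (p (?e m))) \<longlonglongrightarrow> dist y (p S)"
      by (intro tendsto_dist tendsto_const cont[OF S] e(1) S0)
    ultimately show ?thesis
      using tendsto_lowerbound[of _ "dist y (p S)" sequentially s] by auto
  qed
  ultimately show thesis using that S S0 by blast
qed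

text \<open>Up to a time \<open>l\<close> before the exit, the distance of the path from the centre
  has a maximum below \<open>r\<close>. Once \<open>s j\<close> exceeds it, the path cannot be
  outside \<open>ball y (s j)\<close> by time \<open>l\<close>, so \<open>S j > l\<close>.\<close>

lemma tendsto_capped_exit:
  fixes p :: "real \<Rightarrow> 'a::euclidean_space"
  assumes p: "continuous_on {0..} p" and T: "0 < T"
    and s: "s \<longlonglongrightarrow> r" and S0: "\<And>j. 0 \<le> S j" and SU: "\<And>j. S j \<le> capped_exit p (ball y r) T"
    and Sp: "\<And>j. S j < T \<Longrightarrow> p (S j) \<notin> ball y (s j)"
  shows "S \<longlonglongrightarrow> capped_exit p (ball y r) T"
proof (rule order_tendstoI)
  let ?U = "capped_exit p (ball y r) T"
  note U = capped_exit[OF p open_ball[of y r] less_imp_le[OF T]]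
  fix l assume l: "l < ?U"
  show "eventually (\<lambda>j. l < S j) sequentially"
  proof (cases "l < 0")
    case True
    then show ?thesis using S0 by (intro always_eventually allI) (metis less_le_trans)
  next
    case False
    have "continuous_on {0..l} (\<lambda>t. dist y (p t))"
      by (intro continuous_intros continuous_on_subset[OF p]) auto
    then obtain t where t: "t \<in> {0..l}" "\<And>u. u \<in> {0..l} \<Longrightarrow> dist y (p u) \<le> dist y (p t)"
      using continuous_attains_sup[of "{0..l}" "\<lambda>t. dist y (p t)"] False by auto
    have "dist y (p t) < r" using U(4)[of t] t(1) l by auto
    then have "eventually (\<lambda>j. dist y (p t) < s j) sequentially" by (rule order_tendstoD[OF s])
    then show ?thesis
    proof eventually_elim
      case (elim j)
      show ?case
      proof (rule ccontr)
        assume "\<not> l < S j"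
        then show False using Sp[of j] t(2)[of "S j"] elim S0[of j] l U(2) by auto
      qed
    qed
  qed
next
  fix u assume "capped_exit p (ball y r) T < u"
  then show "eventually (\<lambda>j. S j < u) sequentially"
    using SU by (intro always_eventually allI) (metis le_less_trans)
qed

text \<open>Whether the path ever leaves the ball is decided by the countably many capped positions.
  If none is outside, the exit time is infinite and the default value is the centre; otherwise these
  positions are eventually constant. This makes the exit point accessible to measurability and limit
  arguments.\<close>

lemma exit_point_cases:
  fixes y b :: "'a::euclidean_space" and \<sigma> :: real
  assumes p: "continuous_on {0..} (\<lambda>t. W t \<omega>)" and W0: "W 0 \<omega> = 0" and r: "0 < r"
  defines "P \<equiv> \<lambda>t. drift_process b \<sigma> W y t \<omega>"
  shows "(\<forall>n. P (capped_exit P (ball y r) (real (Suc n))) \<in> ball y r) \<Longrightarrow>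
      exit_point b \<sigma> W y r \<omega> = y \<and> (\<forall>t\<ge>0. P t \<in> ball y r)"
    and "\<not> (\<forall>n. P (capped_exit P (ball y r) (real (Suc n))) \<in> ball y r) \<Longrightarrow>
      eventually (\<lambda>n. P (capped_exit P (ball y r) (real (Suc n))) = exit_point b \<sigma> W y r \<omega>) sequentially
      \<and> dist y (exit_point b \<sigma> W y r \<omega>) = r"
proof -
  have P: "continuous_on {0..} P"
    unfolding P_def drift_process_def by (intro continuous_intros p)
  have P0: "P 0 = y" by (simp add: P_def drift_process_def W0)
  let ?B = "ball y r" and ?E = "{ereal t |t. 0 < t \<and> P t \<notin> ball y r}"
  note U = capped_exit[OF P open_ball[of y r]]
  have ep: "exit_point b \<sigma> W y r \<omega> = P (real_of_ereal (Inf ?E))"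
    by (simp add: exit_point_def exit_time_def P_def)
  show "exit_point b \<sigma> W y r \<omega> = y \<and> (\<forall>t\<ge>0. P t \<in> ?B)"
    if all: "\<forall>n. P (capped_exit P ?B (real (Suc n))) \<in> ?B"
  proof -
    have in_B: "P t \<in> ?B" if "0 \<le> t" for t
    proof -
      obtain n where n: "t < real (Suc n)" using reals_Archimedean2[of t] by (metis less_Suc_eq of_nat_less_iff less_trans)
      have "capped_exit P ?B (real (Suc n)) = real (Suc n)"
        using U(2,3)[of "real (Suc n)"] all by (metis of_nat_0_le_iff order_le_less)
      then show ?thesis using U(4)[of "real (Suc n)" t] that n by simp
    qed
    have "?E = {}" using in_B by fastforce
    then have "exit_point b \<sigma> W y r \<omega> = y"
      unfolding ep by (simp only: Inf_empty) (simp add: P0 top_ereal_def)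
    then show ?thesis using in_B by simp
  qed
  show "eventually (\<lambda>n. P (capped_exit P ?B (real (Suc n))) = exit_point b \<sigma> W y r \<omega>) sequentially
      \<and> dist y (exit_point b \<sigma> W y r \<omega>) = r"
    if ex: "\<not> (\<forall>n. P (capped_exit P ?B (real (Suc n))) \<in> ?B)"
  proof -
    obtain n0 where n0: "P (capped_exit P ?B (real (Suc n0))) \<notin> ?B" using ex by auto
    define \<tau> where "\<tau> = capped_exit P ?B (real (Suc n0))"
    have \<tau>B: "P \<tau> \<notin> ?B" "0 \<le> \<tau>" "\<And>t. 0 \<le> t \<Longrightarrow> t < \<tau> \<Longrightarrow> P t \<in> ?B"
      using n0 U(1,4)[of "real (Suc n0)"] by (auto simp: \<tau>_def)
    have \<tau>0: "0 < \<tau>" using \<tau>B P0 r by (cases "\<tau> = 0") auto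
    have "Inf ?E = ereal \<tau>"
    proof (rule antisym)
      show "Inf ?E \<le> ereal \<tau>" using \<tau>B \<tau>0 by (intro Inf_lower) auto
      show "ereal \<tau> \<le> Inf ?E"
      proof (rule Inf_greatest)
        fix x assume "x \<in> ?E"
        then obtain t where "x = ereal t" "0 < t" "P t \<notin> ?B" by auto
        then show "ereal \<tau> \<le> x" using \<tau>B(3)[of t] by (cases "t < \<tau>") auto
      qed
    qed
    then have e\<tau>: "exit_point b \<sigma> W y r \<omega> = P \<tau>" by (simp add: ep)
    have eq: "capped_exit P ?B (real (Suc n)) = \<tau>" if "\<tau> < real (Suc n)" for n
    proof (rule antisym)
      let ?c = "capped_exit P ?B (real (Suc n))"
      show "?c \<le> \<tau>" using U(4)[of "real (Suc n)" \<tau>] \<tau>B by force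
      then show "\<tau> \<le> ?c" using U(1,3)[of "real (Suc n)"] \<tau>B(3)[of ?c] that by force
    qed
    have "eventually (\<lambda>n. \<tau> < real (Suc n)) sequentially"
      by (metis filterlim_at_top_dense filterlim_real_sequentially filterlim_sequentially_Suc)
    then have "eventually (\<lambda>n. P (capped_exit P ?B (real (Suc n))) = exit_point b \<sigma> W y r \<omega>) sequentially"
      by eventually_elim (simp only: eq e\<tau>)
    moreover have "dist y (P \<tau>) \<le> r"
    proof -
      \<comment> \<open>Times tending to \<open>\<tau>\<close> from strictly below, at which the
        path is still inside: the exit position lies in the closed ball.\<close>
      define t where "t = (\<lambda>n. \<tau> * (1 - 1 / real (Suc n)))"
      have t0: "0 \<le> t n" "t n < \<tau>" for n using \<tau>0 by (auto simp: t_def field_simps)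
      have "(\<lambda>n. \<tau> * (1 - 1 / real (Suc n))) \<longlonglongrightarrow> \<tau> * (1 - 0)"
        by (intro tendsto_intros LIMSEQ_Suc[OF lim_1_over_n])
      then have "t \<longlonglongrightarrow> \<tau>" by (simp add: t_def)
      then have "(\<lambda>n. P (t n)) \<longlonglongrightarrow> P \<tau>"
        by (rule continuous_on_tendsto_compose[OF P]) (use t0 \<tau>0 in auto)
      then have "(\<lambda>n. dist y (P (t n))) \<longlonglongrightarrow> dist y (P \<tau>)" by (intro tendsto_intros)
      then show ?thesis
        using \<tau>B(3)[OF t0] by (intro LIMSEQ_le_const2) (auto intro: less_imp_le)
    qed
    ultimately show ?thesis using \<tau>B(1) by (simp add: e\<tau>)
  qed
qed


section \<open>Exit of the drifted Brownian motion from a ball\<close>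

locale drifted_brownian_motion =
  fixes M :: "'w measure" and W :: "real \<Rightarrow> 'w \<Rightarrow> 'a::euclidean_space" and a \<sigma> :: real and b :: 'a
  assumes bm: "standard_brownian_motion M W" and a_pos: "0 < a" and \<sigma>_eq: "\<sigma> = sqrt (2 * a)"
begin

sublocale prob_space M
  using bm by (simp add: standard_brownian_motion_def)

abbreviation X :: "'a \<Rightarrow> 'w \<Rightarrow> real \<Rightarrow> 'a" where
  "X y \<omega> \<equiv> \<lambda>t. drift_process b \<sigma> W y t \<omega>"

text \<open>The inequality makes one notion cover both the barrier and the negated exponentials. It
  concerns \<open>D\<close> alone; continuity and bounds outside \<open>D\<close> are asked for
  separately.\<close>

definition supersolution :: "'a set \<Rightarrow> ('a \<Rightarrow> real) \<Rightarrow> bool" where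
  "supersolution D h \<longleftrightarrow>
     (\<exists>g H. C2_on D h g H \<and> (\<forall>x\<in>D. a * (\<Sum>i\<in>Basis. blinfun_apply (H x) i \<bullet> i) + b \<bullet> g x \<le> 0))"

lemma \<sigma>_pos: "0 < \<sigma>" using a_pos \<sigma>_eq by simp

lemma W_measurable: "0 \<le> t \<Longrightarrow> W t \<in> borel_measurable M"
  using bm by (simp add: standard_brownian_motion_def)

lemma W_path: "\<omega> \<in> space M \<Longrightarrow> W 0 \<omega> = 0" "\<omega> \<in> space M \<Longrightarrow> continuous_on {0..} (\<lambda>t. W t \<omega>)"
  using bm by (auto simp: standard_brownian_motion_def)

lemma W_increment:
  assumes "0 \<le> s" "s < t"
  shows "distributed M lborel (\<lambda>\<omega>. W t \<omega> - W s \<omega>) (\<lambda>z. ennreal (gaussian_density (t - s) z))"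
  using bm assms by (auto simp: standard_brownian_motion_def)

lemma W_grid_indep:
  assumes "0 \<le> \<delta>"
  shows "indep_vars (\<lambda>_. borel) (\<lambda>i \<omega>. W (real (Suc i) * \<delta>) \<omega> - W (real i * \<delta>) \<omega>) {..<n}"
proof -
  have "\<forall>(n::nat) (ts::nat \<Rightarrow> real). 0 \<le> ts 0 \<longrightarrow> (\<forall>i<n. ts i \<le> ts (Suc i)) \<longrightarrow>
        indep_vars (\<lambda>_. borel) (\<lambda>i \<omega>. W (ts (Suc i)) \<omega> - W (ts i) \<omega>) {..<n}"
    using bm unfolding standard_brownian_motion_def by blast
  from this[rule_format, of "\<lambda>i. real i * \<delta>" n] show ?thesis
    using assms by (simp add: mult_right_mono)
qed

lemma X_path:
  assumes "\<omega> \<in> space M"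
  shows "X y \<omega> 0 = y" "continuous_on {0..} (X y \<omega>)"
  using W_path[OF assms] unfolding drift_process_def by (auto intro!: continuous_intros)

lemma X_increment:
  "X y \<omega> t - X y \<omega> s = (t - s) *\<^sub>R b + \<sigma> *\<^sub>R (W t \<omega> - W s \<omega>)"
  by (simp add: drift_process_def algebra_simps)

lemma X_grid_exit_eq_walk:
  assumes "\<omega> \<in> space M"
  shows "X y \<omega> (grid_exit (X y \<omega>) B T m) = stopped_walk B y
     (\<lambda>k. (T / 2 ^ m) *\<^sub>R b + \<sigma> *\<^sub>R (W (real (Suc k) * (T / 2 ^ m)) \<omega> - W (real k * (T / 2 ^ m)) \<omega>)) (2 ^ m)"
proof -
  have grid_step: "real (Suc k) * d - real k * d = d" for k and d :: real by (simp add: algebra_simps)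
  let ?S = "\<lambda>k::nat. X y \<omega> (real k * (T / 2 ^ m))"
  have "(\<lambda>k. ?S (Suc k) - ?S k) =
     (\<lambda>k. (T / 2 ^ m) *\<^sub>R b + \<sigma> *\<^sub>R (W (real (Suc k) * (T / 2 ^ m)) \<omega> - W (real k * (T / 2 ^ m)) \<omega>))"
    unfolding X_increment by (simp only: grid_step)
  moreover have "?S 0 = y" using X_path[OF assms] by simp
  ultimately show ?thesis
    using stopped_walk_eq_path[of B ?S "2 ^ m"] by (simp only: grid_exit_def)
qed

lemma X_grid_exit_measurable:
  assumes [measurable]: "B \<in> sets borel" and T: "0 < T"
  shows "(\<lambda>\<omega>. X y \<omega> (grid_exit (X y \<omega>) B T m)) \<in> borel_measurable M"
proof -
  have [measurable]: "(\<lambda>\<omega>. W (real k * (T / 2 ^ m)) \<omega>) \<in> borel_measurable M" for k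
    using T by (intro W_measurable) auto
  have "(\<lambda>\<omega>. stopped_walk B y (\<lambda>k. (T / 2 ^ m) *\<^sub>R b +
      \<sigma> *\<^sub>R (W (real (Suc k) * (T / 2 ^ m)) \<omega> - W (real k * (T / 2 ^ m)) \<omega>)) (2 ^ m)) \<in> borel_measurable M"
    by (rule measurable_stopped_walk) measurable
  then show ?thesis
    by (subst measurable_cong[OF X_grid_exit_eq_walk]) auto
qed

text \<open>Each of the \<open>2 ^ m\<close> steps costs at most \<open>\<eta> * T / 2 ^ m\<close>,
  so the total \<open>\<eta> * T\<close> is independent of the mesh; \<open>m\<close> only has to be
  large enough for the one-step estimate to apply.\<close>

lemma X_grid_exit_supersolution:
  assumes sup: "supersolution (ball y r) h" and h: "h \<in> borel_measurable borel" "\<And>x. \<bar>h x\<bar> \<le> C"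
    and s: "s < r" and T: "0 < T" and \<eta>: "0 < \<eta>"
  shows "eventually (\<lambda>m. (\<integral>\<omega>. h (X y \<omega> (grid_exit (X y \<omega>) (ball y s) T m)) \<partial>M) \<le> h y + \<eta> * T) sequentially"
proof -
  obtain g H where C2: "C2_on (ball y r) h g H"
    and L: "\<And>x. x \<in> ball y r \<Longrightarrow> a * (\<Sum>i\<in>Basis. blinfun_apply (H x) i \<bullet> i) + b \<bullet> g x \<le> 0"
    using sup by (auto simp: supersolution_def)
  obtain \<delta> where \<delta>: "0 < \<delta>" "\<And>t z (M :: 'w measure) (G :: 'w \<Rightarrow> 'a). 0 < t \<Longrightarrow> t < \<delta> \<Longrightarrow> z \<in> ball y s \<Longrightarrow> prob_space M \<Longrightarrow>
       distributed M lborel G (\<lambda>z. ennreal (gaussian_density t z)) \<Longrightarrow>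
       (\<integral>\<omega>. h (z + (t *\<^sub>R b + \<sigma> *\<^sub>R G \<omega>)) \<partial>M) \<le> h z + \<eta> * t"
    using one_step_supersolution[OF a_pos \<sigma>_eq C2 L h s \<eta>] by blast
  have "(\<lambda>m. T * (1 / 2) ^ m) \<longlonglongrightarrow> T * 0" by (intro tendsto_intros) auto
  then have "eventually (\<lambda>m. T / 2 ^ m < \<delta>) sequentially"
    using order_tendstoD(2)[of _ 0 sequentially \<delta>] \<delta>(1) by (simp add: power_one_over)
  then show ?thesis
  proof eventually_elim
    case (elim m)
    let ?d = "T / 2 ^ m"
    let ?\<xi> = "\<lambda>k \<omega>. ?d *\<^sub>R b + \<sigma> *\<^sub>R (W (real (Suc k) * ?d) \<omega> - W (real k * ?d) \<omega>)"
    have d: "0 < ?d" using T by simp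
    have "indep_vars (\<lambda>_. borel) (\<lambda>k \<omega>. (\<lambda>w. ?d *\<^sub>R b + \<sigma> *\<^sub>R w) (W (real (Suc k) * ?d) \<omega> - W (real k * ?d) \<omega>)) {..<2 ^ m}"
      by (rule indep_vars_compose2[OF W_grid_indep]) (use d in auto)
    then have "(\<integral>\<omega>. h (stopped_walk (ball y s) y (\<lambda>k. ?\<xi> k \<omega>) (2 ^ m)) \<partial>M) \<le> h y + real (2 ^ m) * (\<eta> * ?d)"
    proof (rule stopped_walk_supersolution[where C=C])
      fix k z assume z: "z \<in> ball y s"
      have "real k * ?d < real (Suc k) * ?d" using d by (intro mult_strict_right_mono) auto
      then have "distributed M lborel (\<lambda>\<omega>. W (real (Suc k) * ?d) \<omega> - W (real k * ?d) \<omega>)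
         (\<lambda>z. ennreal (gaussian_density (real (Suc k) * ?d - real k * ?d) z))"
        using T by (intro W_increment) auto
      moreover have "real (Suc k) * ?d - real k * ?d = ?d" unfolding left_diff_distrib[symmetric] by simp
      ultimately have "distributed M lborel (\<lambda>\<omega>. W (real (Suc k) * ?d) \<omega> - W (real k * ?d) \<omega>) (\<lambda>z. ennreal (gaussian_density ?d z))"
        by (simp only:)
      from \<delta>(2)[OF d elim z prob_space_axioms this]
      show "(\<integral>\<omega>. h (z + ?\<xi> k \<omega>) \<partial>M) \<le> h z + \<eta> * ?d" .
    qed (use h T \<eta> in auto)
    also have "real (2 ^ m) * (\<eta> * ?d) = \<eta> * T" by simp
    finally show ?case
      by (subst Bochner_Integration.integral_cong[OF refl, of M _ "\<lambda>\<omega>. h (stopped_walk (ball y s) y (\<lambda>k. ?\<xi> k \<omega>) (2 ^ m))"])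
         (simp_all only: X_grid_exit_eq_walk)
  qed
qed

lemma tendsto_expectation:
  fixes V :: "nat \<Rightarrow> 'w \<Rightarrow> 'a" and h :: "'a \<Rightarrow> real"
  assumes V: "\<And>n. V n \<in> borel_measurable M" "U \<in> borel_measurable M" "AE \<omega> in M. (\<lambda>n. V n \<omega>) \<longlonglongrightarrow> U \<omega>"
    and h: "continuous_on UNIV h" "\<And>x. \<bar>h x\<bar> \<le> C"
  shows "(\<lambda>n. \<integral>\<omega>. h (V n \<omega>) \<partial>M) \<longlonglongrightarrow> (\<integral>\<omega>. h (U \<omega>) \<partial>M)"
proof (rule integral_dominated_convergence[where w="\<lambda>_. C"])
  have [measurable]: "h \<in> borel_measurable borel" using h(1) by (rule borel_measurable_continuous_onI)
  note [measurable] = V(1,2)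
  show "(\<lambda>\<omega>. h (U \<omega>)) \<in> borel_measurable M" "\<And>n. (\<lambda>\<omega>. h (V n \<omega>)) \<in> borel_measurable M" by measurable
  show "AE \<omega> in M. (\<lambda>n. h (V n \<omega>)) \<longlonglongrightarrow> h (U \<omega>)"
    using V(3) by eventually_elim (use h(1) in \<open>auto intro: continuous_on_tendsto_compose\<close>)
qed (use h(2) in auto)

text \<open>First limit: the mesh tends to zero, for a fixed inner radius. The time \<open>S\<close>
  is chosen path by path; measurability is claimed only for the position at \<open>S\<close>, which
  is a limit of positions at grid exits.\<close>

lemma grid_limit:
  assumes s: "s < r" and T: "0 < T"
  obtains S where "\<And>\<omega>. \<omega> \<in> space M \<Longrightarrow> 0 \<le> S \<omega> \<and> S \<omega> \<le> capped_exit (X y \<omega>) (ball y r) T \<and>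
      (S \<omega> < T \<longrightarrow> X y \<omega> (S \<omega>) \<notin> ball y s)"
    and "(\<lambda>\<omega>. X y \<omega> (S \<omega>)) \<in> borel_measurable M"
    and "\<And>h C. supersolution (ball y r) h \<Longrightarrow> continuous_on UNIV h \<Longrightarrow> (\<And>x. \<bar>h x\<bar> \<le> C) \<Longrightarrow>
      (\<integral>\<omega>. h (X y \<omega> (S \<omega>)) \<partial>M) \<le> h y"
proof -
  let ?e = "\<lambda>\<omega>. grid_exit (X y \<omega>) (ball y s) T"
  have "\<exists>S. \<forall>\<omega>. \<omega> \<in> space M \<longrightarrow> (?e \<omega> \<longlonglongrightarrow> S \<omega> \<and> 0 \<le> S \<omega> \<and> S \<omega> \<le> capped_exit (X y \<omega>) (ball y r) T \<and>
      (S \<omega> < T \<longrightarrow> X y \<omega> (S \<omega>) \<notin> ball y s))"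
  proof (rule choice, rule allI)
    fix \<omega>
    show "\<exists>S. \<omega> \<in> space M \<longrightarrow> (?e \<omega> \<longlonglongrightarrow> S \<and> 0 \<le> S \<and> S \<le> capped_exit (X y \<omega>) (ball y r) T \<and>
      (S < T \<longrightarrow> X y \<omega> S \<notin> ball y s))"
    proof (cases "\<omega> \<in> space M")
      case True
      show ?thesis by (rule grid_exit_limit[OF X_path(2)[OF True, of y] T s, of y]) blast
    qed simp
  qed
  then obtain S where S: "\<And>\<omega>. \<omega> \<in> space M \<Longrightarrow> ?e \<omega> \<longlonglongrightarrow> S \<omega>" and
    S': "\<And>\<omega>. \<omega> \<in> space M \<Longrightarrow> 0 \<le> S \<omega> \<and> S \<omega> \<le> capped_exit (X y \<omega>) (ball y r) T \<and>
      (S \<omega> < T \<longrightarrow> X y \<omega> (S \<omega>) \<notin> ball y s)" by blast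
  have lim: "(\<lambda>m. X y \<omega> (?e \<omega> m)) \<longlonglongrightarrow> X y \<omega> (S \<omega>)" if \<omega>: "\<omega> \<in> space M" for \<omega>
    by (rule continuous_on_tendsto_compose[OF X_path(2)[OF \<omega>] S[OF \<omega>]])
       (use S'[OF \<omega>] grid_exit(1)[OF T] in \<open>auto intro!: always_eventually\<close>)
  have meas: "(\<lambda>\<omega>. X y \<omega> (?e \<omega> m)) \<in> borel_measurable M" for m
    by (rule X_grid_exit_measurable[OF _ T]) simp
  have measS: "(\<lambda>\<omega>. X y \<omega> (S \<omega>)) \<in> borel_measurable M"
    by (rule borel_measurable_LIMSEQ_metric[OF meas lim])
  show thesis
  proof (rule that[OF S' measS])
    fix h and C :: real
    assume sup: "supersolution (ball y r) h" and h: "continuous_on UNIV h" "\<And>x. \<bar>h x\<bar> \<le> C"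
    have hm: "h \<in> borel_measurable borel" using h(1) by (rule borel_measurable_continuous_onI)
    have conv: "(\<lambda>m. \<integral>\<omega>. h (X y \<omega> (?e \<omega> m)) \<partial>M) \<longlonglongrightarrow> (\<integral>\<omega>. h (X y \<omega> (S \<omega>)) \<partial>M)"
      by (rule tendsto_expectation[OF meas measS _ h]) (use lim in auto)
    show "(\<integral>\<omega>. h (X y \<omega> (S \<omega>)) \<partial>M) \<le> h y"
    proof (rule field_le_epsilon)
      fix e :: real assume e: "0 < e"
      have "eventually (\<lambda>m. (\<integral>\<omega>. h (X y \<omega> (?e \<omega> m)) \<partial>M) \<le> h y + e / T * T) sequentially"
        by (rule X_grid_exit_supersolution[OF sup hm h(2) s T]) (use e T in auto)
      then show "(\<integral>\<omega>. h (X y \<omega> (S \<omega>)) \<partial>M) \<le> h y + e"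
        using T by (intro tendsto_upperbound[OF conv]) auto
    qed
  qed
qed

text \<open>Second limit: the inner radii increase to \<open>r\<close>. The times from
  \<open>grid_limit\<close> are squeezed onto the capped exit time, and bounded continuity of
  \<open>h\<close> carries the inequality over.\<close>

lemma X_capped_exit:
  assumes T: "0 < T"
  shows "(\<lambda>\<omega>. X y \<omega> (capped_exit (X y \<omega>) (ball y r) T)) \<in> borel_measurable M"
    and "supersolution (ball y r) h \<Longrightarrow> continuous_on UNIV h \<Longrightarrow> (\<And>x. \<bar>h x\<bar> \<le> C) \<Longrightarrow>
      (\<integral>\<omega>. h (X y \<omega> (capped_exit (X y \<omega>) (ball y r) T)) \<partial>M) \<le> h y"
proof -
  let ?U = "\<lambda>\<omega>. capped_exit (X y \<omega>) (ball y r) T"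
  define s where "s = (\<lambda>j. r - inverse (real (Suc j)))"
  have s: "s j < r" for j by (simp add: s_def)
  have "s \<longlonglongrightarrow> r - 0" unfolding s_def by (intro tendsto_intros LIMSEQ_inverse_real_of_nat)
  then have s_lim: "s \<longlonglongrightarrow> r" by simp
  define P where "P = (\<lambda>j S. (\<forall>\<omega>\<in>space M. 0 \<le> S \<omega> \<and> S \<omega> \<le> ?U \<omega> \<and> (S \<omega> < T \<longrightarrow> X y \<omega> (S \<omega>) \<notin> ball y (s j)))
    \<and> (\<lambda>\<omega>. X y \<omega> (S \<omega>)) \<in> borel_measurable M
    \<and> (\<forall>h C. supersolution (ball y r) h \<longrightarrow> continuous_on UNIV h \<longrightarrow> (\<forall>x. \<bar>h x\<bar> \<le> C) \<longrightarrow>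
      (\<integral>\<omega>. h (X y \<omega> (S \<omega>)) \<partial>M) \<le> h y))"
  have "\<exists>S. P j S" for j
    unfolding P_def by (rule grid_limit[OF s[of j] T, of y]) blast
  then obtain S where "\<And>j. P j (S j)" using choice[of P] by blast
  then have S: "\<And>j \<omega>. \<omega> \<in> space M \<Longrightarrow> 0 \<le> S j \<omega> \<and> S j \<omega> \<le> ?U \<omega> \<and> (S j \<omega> < T \<longrightarrow> X y \<omega> (S j \<omega>) \<notin> ball y (s j))"
    and Sm: "\<And>j. (\<lambda>\<omega>. X y \<omega> (S j \<omega>)) \<in> borel_measurable M"
    and Sh: "\<And>j h C. supersolution (ball y r) h \<Longrightarrow> continuous_on UNIV h \<Longrightarrow> (\<forall>x. \<bar>h x\<bar> \<le> C) \<Longrightarrow>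
      (\<integral>\<omega>. h (X y \<omega> (S j \<omega>)) \<partial>M) \<le> h y"
    unfolding P_def by blast+
  have lim: "(\<lambda>j. X y \<omega> (S j \<omega>)) \<longlonglongrightarrow> X y \<omega> (?U \<omega>)" if \<omega>: "\<omega> \<in> space M" for \<omega>
  proof (rule continuous_on_tendsto_compose[OF X_path(2)[OF \<omega>]])
    show "(\<lambda>j. S j \<omega>) \<longlonglongrightarrow> ?U \<omega>"
      by (rule tendsto_capped_exit[OF X_path(2)[OF \<omega>] T s_lim]) (use S[OF \<omega>] in auto)
    show "?U \<omega> \<in> {0..}" using capped_exit(1)[OF X_path(2)[OF \<omega>] open_ball] T by simp
  qed (use S[OF \<omega>] in auto)
  show meas: "(\<lambda>\<omega>. X y \<omega> (?U \<omega>)) \<in> borel_measurable M"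
    by (rule borel_measurable_LIMSEQ_metric[OF Sm lim])
  show "(\<integral>\<omega>. h (X y \<omega> (?U \<omega>)) \<partial>M) \<le> h y"
    if sup: "supersolution (ball y r) h" and h: "continuous_on UNIV h" "\<And>x. \<bar>h x\<bar> \<le> C"
  proof -
    have "(\<lambda>j. \<integral>\<omega>. h (X y \<omega> (S j \<omega>)) \<partial>M) \<longlonglongrightarrow> (\<integral>\<omega>. h (X y \<omega> (?U \<omega>)) \<partial>M)"
      by (rule tendsto_expectation[OF Sm meas _ h]) (use lim in auto)
    then show ?thesis using Sh[OF sup h(1)] h(2) by (intro LIMSEQ_le_const2) auto
  qed
qed

section \<open>Almost sure exit and removal of the time cap\<close>

lemma gaussian_density_le:
  fixes z :: 'a
  assumes "0 < t"
  shows "gaussian_density t z \<le> (1 / sqrt (2 * pi * t)) ^ DIM('a)"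
proof -
  have "gaussian_density t z \<le> (\<Prod>i\<in>(Basis::'a set). 1 / sqrt (2 * pi * t))"
    using assms by (intro prod_mono) (auto simp: normal_density_def divide_simps)
  then show ?thesis by simp
qed

text \<open>The Gaussian density at time \<open>t\<close> is at most \<open>(2 * pi * t)\<close> to
  the power \<open>- d / 2\<close>, while the set that \<open>W t\<close> must hit is a translate of
  one fixed ball. The probability of being inside at time \<open>t\<close> thus tends to
  zero.\<close>

lemma exits_ball_AE:
  assumes r: "0 < r"
  shows "AE \<omega> in M. \<exists>t\<ge>0. X y \<omega> t \<notin> ball y r"
proof -
  let ?N = "{\<omega>\<in>space M. \<forall>n. X y \<omega> (real (Suc n)) \<in> ball y r}"
  have [measurable]: "W (real n) \<in> borel_measurable M" for n by (rule W_measurable) simp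
  have Xm[measurable]: "(\<lambda>\<omega>. X y \<omega> (real n)) \<in> borel_measurable M" for n
    unfolding drift_process_def by measurable
  have le: "prob ?N \<le> (1 / sqrt (2 * pi * real (Suc n))) ^ DIM('a) * measure lborel (ball (0::'a) (r / \<sigma>))" for n
  proof -
    define t where "t = real (Suc n)"
    have t: "0 < t" by (simp add: t_def)
    \<comment> \<open>The ball \<open>ball y r\<close> in the coordinates of \<open>W t\<close>: the
      drift moves its centre but leaves its volume unchanged.\<close>
    define A where "A = ball (- (t / \<sigma>) *\<^sub>R b) (r / \<sigma>)"
    have [measurable]: "A \<in> sets borel" by (simp add: A_def)
    have iff: "X y \<omega> t \<in> ball y r \<longleftrightarrow> W t \<omega> \<in> A" for \<omega>
    proof -
      have "X y \<omega> t - y = \<sigma> *\<^sub>R (W t \<omega> - (- (t / \<sigma>) *\<^sub>R b))"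
        using \<sigma>_pos by (simp add: drift_process_def algebra_simps)
      then have "norm (X y \<omega> t - y) = \<sigma> * norm (W t \<omega> - (- (t / \<sigma>) *\<^sub>R b))"
        using \<sigma>_pos by (simp only: norm_scaleR abs_of_pos)
      then have "dist y (X y \<omega> t) = \<sigma> * dist (- (t / \<sigma>) *\<^sub>R b) (W t \<omega>)"
        unfolding dist_norm by (simp only: norm_minus_commute)
      then have "dist y (X y \<omega> t) < r \<longleftrightarrow> dist (- (t / \<sigma>) *\<^sub>R b) (W t \<omega>) * \<sigma> < r"
        by (simp only: mult.commute)
      then show ?thesis unfolding A_def mem_ball pos_less_divide_eq[OF \<sigma>_pos] .
    qed
    let ?G = "\<lambda>\<omega>. W t \<omega> - W 0 \<omega>"
    have G: "distributed M lborel ?G (\<lambda>z. ennreal (gaussian_density t z))"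
      using W_increment[of 0 t] t by simp
    have Gm: "?G \<in> borel_measurable M" using distributed_measurable[OF G] by simp
    have sub: "?N \<subseteq> ?G -` A \<inter> space M"
    proof
      fix \<omega> assume \<omega>: "\<omega> \<in> ?N"
      then have "X y \<omega> t \<in> ball y r" unfolding t_def by blast
      then have "W t \<omega> \<in> A" using iff by blast
      then show "\<omega> \<in> ?G -` A \<inter> space M" using \<omega> W_path(1) by simp
    qed
    have "emeasure M ?N \<le> emeasure M (?G -` A \<inter> space M)"
      by (rule emeasure_mono[OF sub]) (rule measurable_sets[OF Gm], simp add: A_def)
    also have "\<dots> = (\<integral>\<^sup>+z. ennreal (gaussian_density t z) * indicator A z \<partial>lborel)"
      by (rule distributed_emeasure[OF G]) simp
    also have "\<dots> \<le> (\<integral>\<^sup>+z. ennreal ((1 / sqrt (2 * pi * t)) ^ DIM('a)) * indicator A z \<partial>lborel)"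
      using gaussian_density_le[OF t] by (intro nn_integral_mono mult_right_mono ennreal_leI) auto
    also have "\<dots> = ennreal ((1 / sqrt (2 * pi * t)) ^ DIM('a)) * emeasure lborel A"
      by (rule nn_integral_cmult_indicator) simp
    also have "\<dots> = ennreal ((1 / sqrt (2 * pi * t)) ^ DIM('a) * measure lborel A)"
    proof -
      have "emeasure lborel A \<noteq> \<top>"
        using emeasure_lborel_ball_finite[of "- (t / \<sigma>) *\<^sub>R b" "r / \<sigma>"] by (simp add: A_def less_top[symmetric])
      then show ?thesis using t by (simp add: emeasure_eq_ennreal_measure ennreal_mult)
    qed
    finally have "prob ?N \<le> (1 / sqrt (2 * pi * t)) ^ DIM('a) * measure lborel A"
      using t by (simp add: emeasure_eq_measure)
    moreover have "measure lborel A = measure lborel (ball (0::'a) (r / \<sigma>))"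
      using \<sigma>_pos r unfolding A_def by (simp add: content_ball)
    ultimately show ?thesis by (simp only: t_def)
  qed
  have "prob ?N \<le> 0"
  proof (rule LIMSEQ_le_const)
    have "(\<lambda>n. 1 / sqrt (2 * pi) * sqrt (inverse (real (Suc n)))) \<longlonglongrightarrow> 1 / sqrt (2 * pi) * sqrt 0"
      by (intro tendsto_mult tendsto_const tendsto_real_sqrt LIMSEQ_inverse_real_of_nat)
    then have "(\<lambda>n. 1 / sqrt (2 * pi * real (Suc n))) \<longlonglongrightarrow> 0"
      by (simp add: real_sqrt_mult real_sqrt_inverse divide_inverse del: of_nat_Suc)
    from tendsto_power[OF this, of "DIM('a)"]
    have "(\<lambda>n. (1 / sqrt (2 * pi * real (Suc n))) ^ DIM('a) * measure lborel (ball (0::'a) (r / \<sigma>))) \<longlonglongrightarrow> 0 ^ DIM('a) * measure lborel (ball (0::'a) (r / \<sigma>))"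
      by (intro tendsto_mult tendsto_const)
    then show "(\<lambda>n. (1 / sqrt (2 * pi * real (Suc n))) ^ DIM('a) * measure lborel (ball (0::'a) (r / \<sigma>))) \<longlonglongrightarrow> 0"
      by (simp only: zero_power[OF DIM_positive] mult_zero_left)
    show "\<exists>N. \<forall>n\<ge>N. prob ?N \<le> (1 / sqrt (2 * pi * real (Suc n))) ^ DIM('a) * measure lborel (ball (0::'a) (r / \<sigma>))"
      using le by blast
  qed
  then have "prob ?N = 0" by (rule order_antisym) (rule measure_nonneg)
  moreover have "?N \<in> sets M"
  proof -
    have "(\<Inter>n. (\<lambda>\<omega>. X y \<omega> (real (Suc n))) -` ball y r \<inter> space M) \<in> sets M"
      by (intro sets.countable_INT image_subsetI measurable_sets[OF Xm]) simp_all
    moreover have "(\<Inter>n. (\<lambda>\<omega>. X y \<omega> (real (Suc n))) -` ball y r \<inter> space M) = ?N"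
      by (simp only: set_eq_iff INT_iff Int_iff vimage_eq mem_Collect_eq) blast
    ultimately show ?thesis by (simp only:)
  qed
  ultimately have "AE \<omega> in M. \<omega> \<notin> ?N" using prob_eq_0 by blast
  then show ?thesis using AE_space
  proof eventually_elim
    case (elim \<omega>)
    then obtain n where "X y \<omega> (real (Suc n)) \<notin> ball y r" by blast
    then show ?case by (intro exI[of _ "real (Suc n)"]) auto
  qed
qed

text \<open>The ball is empty, every positive time counts, and the infimum is 0. This is why the
  chain stands still once it reaches the frontier.\<close>

lemma exit_point_zero:
  assumes "\<omega> \<in> space M"
  shows "exit_point b \<sigma> W y 0 \<omega> = y"
proof -
  have "Inf {ereal t |t. 0 < t} = (0 :: ereal)"
  proof (rule antisym)
    show "Inf {ereal t |t. 0 < t} \<le> 0"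
    proof (rule ereal_le_epsilon2)
      show "Inf {ereal t |t. 0 < t} \<le> 0 + ereal e" if "0 < e" for e using that by (auto intro: Inf_lower)
    qed
  qed (auto intro!: Inf_greatest)
  then show ?thesis using X_path(1)[OF assms] by (simp add: exit_point_def exit_time_def)
qed

lemma exit_point_AE:
  assumes "0 < r"
  shows "AE \<omega> in M. (\<lambda>n. X y \<omega> (capped_exit (X y \<omega>) (ball y r) (real (Suc n)))) \<longlonglongrightarrow> exit_point b \<sigma> W y r \<omega>
     \<and> dist y (exit_point b \<sigma> W y r \<omega>) = r"
  using exits_ball_AE[OF assms, of y] AE_space
proof eventually_elim
  case (elim \<omega>)
  note cases = exit_point_cases[where b=b and \<sigma>=\<sigma> and y=y and W=W and \<omega>=\<omega>, OF W_path(2,1)[OF elim(2)] assms]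
  have "\<not> (\<forall>n. X y \<omega> (capped_exit (X y \<omega>) (ball y r) (real (Suc n))) \<in> ball y r)"
    using cases(1) elim(1) by blast
  from cases(2)[OF this] show ?case by (auto intro: tendsto_eventually)
qed

lemma exit_point_measurable: "0 \<le> r \<Longrightarrow> exit_point b \<sigma> W y r \<in> borel_measurable M"
proof (cases "r = 0")
  case True
  have "exit_point b \<sigma> W y 0 \<in> borel_measurable M \<longleftrightarrow> (\<lambda>_. y) \<in> borel_measurable M"
    by (rule measurable_cong) (rule exit_point_zero)
  then show ?thesis using True by simp
next
  case False
  assume "0 \<le> r"
  with False have r: "0 < r" by simp
  define V where "V = (\<lambda>n \<omega>. X y \<omega> (capped_exit (X y \<omega>) (ball y r) (real (Suc n))))"
  have [measurable]: "V n \<in> borel_measurable M" for n unfolding V_def by (rule X_capped_exit(1)) simp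
  \<comment> \<open>The identity holds at every point of \<open>space M\<close>: completeness of
    \<open>M\<close> is not assumed, so agreement almost everywhere would not yield
    measurability.\<close>
  have eq: "exit_point b \<sigma> W y r \<omega> = (if \<forall>n. V n \<omega> \<in> ball y r then y else lim (\<lambda>n. V n \<omega>))"
    if \<omega>: "\<omega> \<in> space M" for \<omega>
    using exit_point_cases[where b=b and \<sigma>=\<sigma> and y=y and W=W and \<omega>=\<omega>, OF W_path(2,1)[OF \<omega>] r]
    unfolding V_def by (auto intro!: limI[symmetric] tendsto_eventually)
  have [measurable]: "ball y r \<in> sets borel" by simp
  have "(\<lambda>\<omega>. if \<forall>n. V n \<omega> \<in> ball y r then y else lim (\<lambda>n. V n \<omega>)) \<in> borel_measurable M"
    by measurable
  then show ?thesis by (rule iffD2[OF measurable_cong[OF eq], rotated])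
qed

text \<open>Third limit: the cap tends to infinity, and almost sure exit makes the capped positions
  converge to the exit point.\<close>

lemma exit_point_supersolution:
  assumes sup: "supersolution (ball y r) h" and h: "continuous_on UNIV h" "\<And>x. \<bar>h x\<bar> \<le> C" and r: "0 \<le> r"
  shows "(\<integral>\<omega>. h (exit_point b \<sigma> W y r \<omega>) \<partial>M) \<le> h y"
proof (cases "r = 0")
  case True
  have "(\<integral>\<omega>. h (exit_point b \<sigma> W y r \<omega>) \<partial>M) = (\<integral>\<omega>. h y \<partial>M)"
    unfolding True by (rule Bochner_Integration.integral_cong) (auto simp: exit_point_zero)
  then show ?thesis by (simp add: prob_space)
next
  case False
  with r have r: "0 < r" by simp
  let ?V = "\<lambda>n \<omega>. X y \<omega> (capped_exit (X y \<omega>) (ball y r) (real (Suc n)))"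
  have "(\<lambda>n. \<integral>\<omega>. h (?V n \<omega>) \<partial>M) \<longlonglongrightarrow> (\<integral>\<omega>. h (exit_point b \<sigma> W y r \<omega>) \<partial>M)"
    by (rule tendsto_expectation[OF _ _ _ h])
       (use exit_point_AE[OF r] r in \<open>auto intro!: X_capped_exit(1) exit_point_measurable\<close>)
  then show ?thesis
    using X_capped_exit(2)[OF _ sup h] by (intro LIMSEQ_le_const2) auto
qed

end


section \<open>Convergence of bounded submartingales\<close>

primrec frozen_process :: "real \<Rightarrow> (nat \<Rightarrow> real) \<Rightarrow> nat \<Rightarrow> real" where
  "frozen_process \<epsilon> z 0 = z 0"
| "frozen_process \<epsilon> z (Suc j) =
     (if \<bar>frozen_process \<epsilon> z j - z 0\<bar> < \<epsilon> then z (Suc j) else frozen_process \<epsilon> z j)"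

lemma frozen_process_active:
  "\<bar>frozen_process \<epsilon> z j - z 0\<bar> < \<epsilon> \<Longrightarrow> frozen_process \<epsilon> z j = z j"
  by (cases j) (auto split: if_splits)

lemma frozen_process_bounds:
  "(\<And>i. 0 \<le> z i \<and> z i \<le> C) \<Longrightarrow> 0 \<le> frozen_process \<epsilon> z j \<and> frozen_process \<epsilon> z j \<le> C"
  by (induction j) auto

lemma frozen_process_stays:
  assumes "\<bar>frozen_process \<epsilon> z j - z 0\<bar> < \<epsilon>" "i \<le> j"
  shows "\<bar>z i - z 0\<bar> < \<epsilon>"
  using assms
proof (induction j)
  case (Suc j)
  then have "\<bar>frozen_process \<epsilon> z j - z 0\<bar> < \<epsilon>" by (auto split: if_splits)
  then show ?case using Suc frozen_process_active[OF Suc.prems(1)] by (cases "i = Suc j") auto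
qed auto

text \<open>
  Freeze \<open>Z\<close> at the first time after \<open>k\<close> at which it has moved by \<open>\<epsilon>\<close> away from \<open>Z k\<close>, and let \<open>V\<close> be
  the frozen process. Applied to \<open>Z\<close> and to its square, optional stopping bounds the second moment of
  \<open>V j - Z k\<close> by the increment of the second moment of \<open>Z\<close> from \<open>k\<close> to \<open>k + j\<close>, which replaces
  the upcrossing inequality.
\<close>

lemma (in prob_space) bounded_submartingale_converges:
  fixes Z :: "nat \<Rightarrow> 'a \<Rightarrow> real" and F :: "nat \<Rightarrow> 'a measure" and C :: real
  assumes sub: "\<And>n. subalgebra M (F n)" and mono: "\<And>m n. m \<le> n \<Longrightarrow> sets (F m) \<subseteq> sets (F n)"
    and Z: "\<And>n. Z n \<in> borel_measurable (F n)" and bd: "\<And>n \<omega>. 0 \<le> Z n \<omega> \<and> Z n \<omega> \<le> C"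
    and subm: "\<And>n w K. w \<in> borel_measurable (F n) \<Longrightarrow> (\<And>\<omega>. 0 \<le> w \<omega> \<and> w \<omega> \<le> K) \<Longrightarrow>
      (\<integral>\<omega>. w \<omega> * Z n \<omega> \<partial>M) \<le> (\<integral>\<omega>. w \<omega> * Z (Suc n) \<omega> \<partial>M)"
    and subm2: "\<And>n w K. w \<in> borel_measurable (F n) \<Longrightarrow> (\<And>\<omega>. 0 \<le> w \<omega> \<and> w \<omega> \<le> K) \<Longrightarrow>
      (\<integral>\<omega>. w \<omega> * (Z n \<omega>)\<^sup>2 \<partial>M) \<le> (\<integral>\<omega>. w \<omega> * (Z (Suc n) \<omega>)\<^sup>2 \<partial>M)"
  shows "AE \<omega> in M. convergent (\<lambda>n. Z n \<omega>)"
proof -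
  have C0: "0 \<le> C" using bd[of 0] order_trans by blast
  have Fsp: "space (F n) = space M" for n using sub[of n] by (simp add: subalgebra_def)
  have up: "f \<in> borel_measurable (F n)" if "f \<in> borel_measurable (F m)" "m \<le> n" for f :: "'a \<Rightarrow> real" and m n
    using that mono[OF that(2)] by (auto simp: measurable_def Fsp)
  have down: "f \<in> borel_measurable M" if "f \<in> borel_measurable (F n)" for f :: "'a \<Rightarrow> real" and n
    using measurable_from_subalg[OF sub that] .
  have ZM[measurable]: "Z n \<in> borel_measurable M" for n by (rule down[OF Z])
  have int: "integrable M f" if "f \<in> borel_measurable M" "\<And>\<omega>. \<bar>f \<omega>\<bar> \<le> K" for f :: "'a \<Rightarrow> real" and K
    using that by (intro integrable_const_bound[of _ K]) auto
  \<comment> \<open>The second moments increase and are bounded, so the gap \<open>L - a k\<close>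
    to their limit vanishes; it will control all oscillation after time \<open>k\<close>.\<close>
  define a where "a = (\<lambda>n. \<integral>\<omega>. (Z n \<omega>)\<^sup>2 \<partial>M)"
  have sqb: "x\<^sup>2 \<le> C\<^sup>2" if "0 \<le> x \<and> x \<le> C" for x :: real using that by (intro power_mono) auto
  have prb: "x * y \<le> C * C" "0 \<le> x * y" if "0 \<le> x \<and> x \<le> C" "0 \<le> y \<and> y \<le> C" for x y :: real
    using that by (auto intro!: mult_mono)
  have a_mono: "a n \<le> a (Suc n)" for n using subm2[of "\<lambda>_. 1" n 1] by (simp add: a_def)
  have a_bd: "a n \<le> C\<^sup>2" for n
    unfolding a_def by (rule integral_le_const) (auto intro!: int[of _ "C\<^sup>2"] sqb bd)
  obtain L where L: "a \<longlonglongrightarrow> L" "\<And>n. a n \<le> L"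
    using incseq_convergent[of a "C\<^sup>2"] a_mono a_bd by (metis incseq_SucI)
  have bound: "prob {\<omega>\<in>space M. \<exists>i\<le>j. \<epsilon> \<le> \<bar>Z (k + i) \<omega> - Z k \<omega>\<bar>} \<le> (L - a k) / \<epsilon>\<^sup>2" if \<epsilon>: "0 < \<epsilon>" for \<epsilon> k j
  proof -
    define V where "V = (\<lambda>j \<omega>. frozen_process \<epsilon> (\<lambda>i. Z (k + i) \<omega>) j)"
    have VS: "V (Suc j) \<omega> = (if \<bar>V j \<omega> - Z k \<omega>\<bar> < \<epsilon> then Z (k + Suc j) \<omega> else V j \<omega>)" for j \<omega>
      by (simp add: V_def)
    have Vact: "\<bar>V j \<omega> - Z k \<omega>\<bar> < \<epsilon> \<Longrightarrow> V j \<omega> = Z (k + j) \<omega>" for j \<omega>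
      using frozen_process_active[of \<epsilon> "\<lambda>i. Z (k + i) \<omega>" j] by (simp add: V_def)
    have Vb: "0 \<le> V j \<omega> \<and> V j \<omega> \<le> C" for j \<omega>
      unfolding V_def by (rule frozen_process_bounds) (rule bd)
    have VF: "V j \<in> borel_measurable (F (k + j))" for j
    proof (induction j)
      case 0
      then show ?case using Z[of k] by (simp add: V_def)
    next
      case (Suc j)
      have [measurable]: "V j \<in> borel_measurable (F (k + Suc j))" "Z k \<in> borel_measurable (F (k + Suc j))"
          "Z (k + Suc j) \<in> borel_measurable (F (k + Suc j))"
        using up[OF Suc, of "k + Suc j"] up[OF Z[of k], of "k + Suc j"] Z[of "k + Suc j"] by simp_all
      show ?case unfolding VS by measurable
    qed
    have VM[measurable]: "V j \<in> borel_measurable M" for j by (rule down[OF VF])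
    define A where "A = (\<lambda>j \<omega>. if \<bar>V j \<omega> - Z k \<omega>\<bar> < \<epsilon> then 1 else 0 :: real)"
    have ZkF: "Z k \<in> borel_measurable (F (k + j))" for j by (rule up[OF Z]) simp
    have AF: "A j \<in> borel_measurable (F (k + j))" for j
    proof -
      note [measurable] = VF[of j] ZkF[of j]
      show ?thesis unfolding A_def by measurable
    qed
    have AM[measurable]: "A j \<in> borel_measurable M" for j by (rule down[OF AF])
    have A01: "A j \<omega> = 0 \<or> A j \<omega> = 1" for j \<omega> by (simp add: A_def)
    have Asw: "(1 - A j \<omega>) * V j \<omega> = V j \<omega> - A j \<omega> * Z (k + j) \<omega>"
              "(1 - A j \<omega>) * (V j \<omega>)\<^sup>2 = (V j \<omega>)\<^sup>2 - A j \<omega> * (Z (k + j) \<omega>)\<^sup>2" for j \<omega>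
      using Vact[of j \<omega>] by (auto simp: A_def)
    have VS': "V (Suc j) \<omega> = V j \<omega> + A j \<omega> * (Z (Suc (k + j)) \<omega> - Z (k + j) \<omega>)" for j \<omega>
      using Vact[of j \<omega>] by (simp add: VS A_def)
    have V2: "(V (Suc j) \<omega>)\<^sup>2 - (Z (Suc (k + j)) \<omega>)\<^sup>2 = (V j \<omega>)\<^sup>2 - (Z (k + j) \<omega>)\<^sup>2
       - ((1 - A j \<omega>) * (Z (Suc (k + j)) \<omega>)\<^sup>2 - (1 - A j \<omega>) * (Z (k + j) \<omega>)\<^sup>2)" for j \<omega>
      using Vact[of j \<omega>] by (auto simp: VS A_def)
    have bnds: "\<bar>(V j \<omega>)\<^sup>2\<bar> \<le> C\<^sup>2" "\<bar>(Z n \<omega>)\<^sup>2\<bar> \<le> C\<^sup>2" "\<bar>V j \<omega> * Z n \<omega>\<bar> \<le> C * C"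
      "\<bar>(1 - A j \<omega>) * (Z n \<omega>)\<^sup>2\<bar> \<le> C\<^sup>2" "\<bar>A j \<omega> * Z m \<omega> * Z n \<omega>\<bar> \<le> C * C"  for j \<omega> n m
      using sqb[OF Vb[of j \<omega>]] sqb[OF bd[of n \<omega>]] prb[OF Vb[of j \<omega>] bd[of n \<omega>]] prb[OF bd[of m \<omega>] bd[of n \<omega>]] A01[of j \<omega>] C0
      by auto
    have ints: "integrable M (\<lambda>\<omega>. (V j \<omega>)\<^sup>2)" "integrable M (\<lambda>\<omega>. (Z n \<omega>)\<^sup>2)" "integrable M (\<lambda>\<omega>. V j \<omega> * Z n \<omega>)"
       "integrable M (\<lambda>\<omega>. (1 - A j \<omega>) * (Z n \<omega>)\<^sup>2)" "integrable M (\<lambda>\<omega>. A j \<omega> * Z m \<omega> * Z n \<omega>)" for j n m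
      by (rule int; use bnds in measurable; fact bnds)+
    \<comment> \<open>While active, \<open>V\<close> copies \<open>Z\<close>. The difference of the
      squares changes only on frozen steps, where the square of \<open>Z\<close> still grows in
      mean: \<open>subm2\<close> with weight \<open>1 - A j\<close>.\<close>
    have 1: "(\<integral>\<omega>. (V j \<omega>)\<^sup>2 \<partial>M) - a (k + j) \<le> 0" for j
    proof (induction j)
      case 0
      show ?case by (simp add: V_def a_def)
    next
      case (Suc j)
      have "(\<lambda>\<omega>. 1 - A j \<omega>) \<in> borel_measurable (F (k + j))" using AF by measurable
      then have le: "(\<integral>\<omega>. (1 - A j \<omega>) * (Z (k + j) \<omega>)\<^sup>2 \<partial>M) \<le> (\<integral>\<omega>. (1 - A j \<omega>) * (Z (Suc (k + j)) \<omega>)\<^sup>2 \<partial>M)"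
        by (rule subm2[of _ _ 1]) (use A01 in \<open>auto simp: A_def\<close>)
      have "(\<integral>\<omega>. (V (Suc j) \<omega>)\<^sup>2 \<partial>M) - a (k + Suc j) = (\<integral>\<omega>. (V (Suc j) \<omega>)\<^sup>2 - (Z (Suc (k + j)) \<omega>)\<^sup>2 \<partial>M)"
        using ints by (simp add: a_def)
      also have "\<dots> = (\<integral>\<omega>. (V j \<omega>)\<^sup>2 \<partial>M) - a (k + j) - ((\<integral>\<omega>. (1 - A j \<omega>) * (Z (Suc (k + j)) \<omega>)\<^sup>2 \<partial>M)
          - (\<integral>\<omega>. (1 - A j \<omega>) * (Z (k + j) \<omega>)\<^sup>2 \<partial>M))"
        unfolding V2 using ints by (simp add: a_def)
      finally show ?case using le Suc by linarith
    qed
    \<comment> \<open>On active steps \<open>V\<close> has the increments of \<open>Z\<close>. The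
      weight \<open>A j * Z k\<close> is known at time \<open>k + j\<close> and nonnegative because
      \<open>Z\<close> is, so \<open>subm\<close> applies.\<close>
    have 2: "a k \<le> (\<integral>\<omega>. V j \<omega> * Z k \<omega> \<partial>M)" for j
    proof (induction j)
      case 0
      show ?case by (simp add: V_def a_def power2_eq_square)
    next
      case (Suc j)
      have "(\<lambda>\<omega>. A j \<omega> * Z k \<omega>) \<in> borel_measurable (F (k + j))" using AF[of j] ZkF[of j] by measurable
      then have le: "(\<integral>\<omega>. A j \<omega> * Z k \<omega> * Z (k + j) \<omega> \<partial>M) \<le> (\<integral>\<omega>. A j \<omega> * Z k \<omega> * Z (Suc (k + j)) \<omega> \<partial>M)"
        by (rule subm[of _ _ C]) (use bd C0 in \<open>auto simp: A_def\<close>)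
      have "V (Suc j) \<omega> * Z k \<omega> = V j \<omega> * Z k \<omega> + (A j \<omega> * Z k \<omega> * Z (Suc (k + j)) \<omega> - A j \<omega> * Z k \<omega> * Z (k + j) \<omega>)" for \<omega>
        by (simp add: VS' algebra_simps)
      then have "(\<integral>\<omega>. V (Suc j) \<omega> * Z k \<omega> \<partial>M) = (\<integral>\<omega>. V j \<omega> * Z k \<omega> \<partial>M) +
         ((\<integral>\<omega>. A j \<omega> * Z k \<omega> * Z (Suc (k + j)) \<omega> \<partial>M) - (\<integral>\<omega>. A j \<omega> * Z k \<omega> * Z (k + j) \<omega> \<partial>M))"
        using ints by simp
      then show ?case using le Suc by linarith
    qed
    have sub1: "{\<omega>\<in>space M. \<exists>i\<le>j. \<epsilon> \<le> \<bar>Z (k + i) \<omega> - Z k \<omega>\<bar>} \<subseteq> {\<omega>\<in>space M. \<epsilon>\<^sup>2 \<le> (V j \<omega> - Z k \<omega>)\<^sup>2}"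
    proof safe
      fix \<omega> i assume i: "i \<le> j" "\<epsilon> \<le> \<bar>Z (k + i) \<omega> - Z k \<omega>\<bar>"
      have "\<not> \<bar>V j \<omega> - Z k \<omega>\<bar> < \<epsilon>"
        using frozen_process_stays[of \<epsilon> "\<lambda>i. Z (k + i) \<omega>" j i] i by (auto simp: V_def)
      then show "\<epsilon>\<^sup>2 \<le> (V j \<omega> - Z k \<omega>)\<^sup>2"
        using \<epsilon> by (intro abs_le_square_iff[THEN iffD1]) auto
    qed
    have sq: "(V j \<omega> - Z k \<omega>)\<^sup>2 = (V j \<omega>)\<^sup>2 + (Z k \<omega>)\<^sup>2 - 2 * (V j \<omega> * Z k \<omega>)" for \<omega>
      by (simp add: power2_diff)
    have "prob {\<omega>\<in>space M. \<exists>i\<le>j. \<epsilon> \<le> \<bar>Z (k + i) \<omega> - Z k \<omega>\<bar>} \<le> prob {\<omega>\<in>space M. \<epsilon>\<^sup>2 \<le> (V j \<omega> - Z k \<omega>)\<^sup>2}"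
      by (intro finite_measure_mono sub1) measurable
    also have "\<dots> \<le> (\<integral>\<omega>. (V j \<omega> - Z k \<omega>)\<^sup>2 \<partial>M) / \<epsilon>\<^sup>2"
    proof (rule integral_Markov_inequality_measure[where A="space M"])
      show "integrable M (\<lambda>\<omega>. (V j \<omega> - Z k \<omega>)\<^sup>2)" unfolding sq using ints by simp
    qed (use \<epsilon> in auto)
    \<comment> \<open>Expanding the square, \<open>1\<close> and \<open>2\<close> give at most
      \<open>a (k + j) + a k - 2 * a k\<close>, that is \<open>a (k + j) - a k\<close>.\<close>
    also have "\<dots> \<le> (L - a k) / \<epsilon>\<^sup>2"
    proof (rule divide_right_mono)
      have "(\<integral>\<omega>. (V j \<omega> - Z k \<omega>)\<^sup>2 \<partial>M) = (\<integral>\<omega>. (V j \<omega>)\<^sup>2 \<partial>M) + a k - 2 * (\<integral>\<omega>. V j \<omega> * Z k \<omega> \<partial>M)"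
        unfolding sq using ints by (simp add: a_def)
      then show "(\<integral>\<omega>. (V j \<omega> - Z k \<omega>)\<^sup>2 \<partial>M) \<le> L - a k" using 1[of j] 2[of j] L(2)[of "k + j"] by linarith
    qed simp
    finally show ?thesis .
  qed
  have small: "AE \<omega> in M. \<exists>k. \<forall>i. \<bar>Z (k + i) \<omega> - Z k \<omega>\<bar> < \<epsilon>" if \<epsilon>: "0 < \<epsilon>" for \<epsilon>
  proof -
    \<comment> \<open>The intersection over \<open>k\<close> of the unions over \<open>j\<close> is
      the event that the oscillation never settles below \<open>\<epsilon>\<close>; its probability
      is at most \<open>(L - a k) / \<epsilon>\<^sup>2\<close> for every \<open>k\<close>.\<close>
    define E where "E = (\<lambda>k j. {\<omega>\<in>space M. \<exists>i\<le>j. \<epsilon> \<le> \<bar>Z (k + i) \<omega> - Z k \<omega>\<bar>})"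
    have Em[measurable]: "E k j \<in> sets M" for k j unfolding E_def by measurable
    have le: "prob (\<Inter>k. \<Union>j. E k j) \<le> (L - a k) / \<epsilon>\<^sup>2" for k
    proof -
      have "(\<lambda>j. prob (E k j)) \<longlonglongrightarrow> prob (\<Union>j. E k j)"
        by (rule finite_Lim_measure_incseq) (auto simp: incseq_def E_def intro: order_trans)
      then have "prob (\<Union>j. E k j) \<le> (L - a k) / \<epsilon>\<^sup>2"
        using bound[OF \<epsilon>, of _ k] by (intro LIMSEQ_le_const2) (auto simp: E_def)
      moreover have "prob (\<Inter>k. \<Union>j. E k j) \<le> prob (\<Union>j. E k j)" by (intro finite_measure_mono) auto
      ultimately show ?thesis by linarith
    qed
    have "(\<lambda>k. (L - a k) / \<epsilon>\<^sup>2) \<longlonglongrightarrow> (L - L) / \<epsilon>\<^sup>2"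
      by (intro tendsto_divide tendsto_diff tendsto_const L(1)) (use \<epsilon> in auto)
    then have "prob (\<Inter>k. \<Union>j. E k j) \<le> 0" using le by (intro LIMSEQ_le_const) auto
    then have "prob (\<Inter>k. \<Union>j. E k j) = 0" using measure_nonneg antisym by metis
    then have "AE \<omega> in M. \<omega> \<notin> (\<Inter>k. \<Union>j. E k j)"
      by (subst (asm) prob_eq_0) auto
    then show ?thesis
      using AE_space
    proof eventually_elim
      case (elim \<omega>)
      then obtain k where k: "\<And>j. \<omega> \<notin> E k j" by auto
      have "\<bar>Z (k + i) \<omega> - Z k \<omega>\<bar> < \<epsilon>" for i
        using k[of i] elim(2) by (force simp: E_def not_le)
      then show ?case by blast
    qed
  qed
  have "AE \<omega> in M. \<forall>n. \<exists>k. \<forall>i. \<bar>Z (k + i) \<omega> - Z k \<omega>\<bar> < inverse (real (Suc n))"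
    by (subst AE_all_countable) (auto intro!: small)
  then show ?thesis
  proof eventually_elim
    case (elim \<omega>)
    have "Cauchy (\<lambda>n. Z n \<omega>)"
    proof (rule metric_CauchyI)
      fix e :: real assume "0 < e"
      then obtain n where n: "inverse (real (Suc n)) < e / 2" using reals_Archimedean[of "e / 2"] by auto
      obtain k where k: "\<And>i. \<bar>Z (k + i) \<omega> - Z k \<omega>\<bar> < inverse (real (Suc n))" using elim by blast
      have "dist (Z m \<omega>) (Z m' \<omega>) < e" if "k \<le> m" "k \<le> m'" for m m'
        using k[of "m - k"] k[of "m' - k"] n that by (simp add: dist_real_def)
      then show "\<exists>K. \<forall>m\<ge>K. \<forall>n\<ge>K. dist (Z m \<omega>) (Z n \<omega>) < e" by blast
    qed
    then show ?case by (rule Cauchy_convergent)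
  qed
qed


section \<open>The chain of exit points\<close>

definition history :: "'w measure \<Rightarrow> (nat \<Rightarrow> 'w \<Rightarrow> 'a::topological_space) \<Rightarrow> nat \<Rightarrow> 'w measure" where
  "history M Y n = vimage_algebra (space M) (\<lambda>\<omega>. \<lambda>i\<in>{..n}. Y i \<omega>) (\<Pi>\<^sub>M i\<in>{..n}. borel)"

lemma space_history [simp]: "space (history M Y n) = space M"
  by (simp add: history_def)

lemma history_measurable:
  fixes Y :: "nat \<Rightarrow> 'w \<Rightarrow> 'a::topological_space"
  assumes "i \<le> n"
  shows "Y i \<in> borel_measurable (history M Y n)"
proof -
  have "(\<lambda>\<omega>. \<lambda>i\<in>{..n}. Y i \<omega>) \<in> measurable (history M Y n) (\<Pi>\<^sub>M i\<in>{..n}. borel)"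
    unfolding history_def by (rule measurable_vimage_algebra1) (auto simp: space_PiM)
  from measurable_compose[OF this measurable_component_singleton[of i]] show ?thesis
    using assms by simp
qed

lemma history_subset:
  assumes "space N = space M" and "\<And>i. i \<le> n \<Longrightarrow> Y i \<in> borel_measurable N"
  shows "sets (history M Y n) \<subseteq> sets N"
  unfolding history_def using assms by (intro sets_image_in_sets measurable_restrict) auto

text \<open>
  Measurability of \<open>K\<close> in its first argument is not available, so \<open>h\<close> is discretised by its level
  sets \<open>\<lfloor>h / \<epsilon>\<rfloor> = j\<close>, where only conditional probabilities of events occur.
\<close>

lemma markov_chain_step_le:
  fixes Y :: "nat \<Rightarrow> 'w \<Rightarrow> 'a::euclidean_space" and h :: "'a \<Rightarrow> real" and w u :: "'w \<Rightarrow> real" and B B' C :: real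
  assumes M: "prob_space M" and mc: "markov_chain_from M K x Y"
    and K: "\<And>y. prob_space (K y)" "\<And>y. sets (K y) = sets borel"
    and h: "h \<in> borel_measurable borel" "\<And>x. \<bar>h x\<bar> \<le> B"
    and w: "w \<in> borel_measurable (history M Y n)" "\<And>\<omega>. 0 \<le> w \<omega> \<and> w \<omega> \<le> C"
    and u: "u \<in> borel_measurable M" "\<And>\<omega>. \<bar>u \<omega>\<bar> \<le> B'"
    and le: "AE \<omega> in M. (\<integral>z. h z \<partial>K (Y n \<omega>)) \<le> u \<omega>"
  shows "(\<integral>\<omega>. w \<omega> * h (Y (Suc n) \<omega>) \<partial>M) \<le> (\<integral>\<omega>. w \<omega> * u \<omega> \<partial>M)"
proof (rule field_le_epsilon)
  fix e :: real assume e: "0 < e"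
  interpret prob_space M by fact
  have Y[measurable]: "Y i \<in> borel_measurable M" for i using mc by (simp add: markov_chain_from_def)
  have sub: "subalgebra M (history M Y n)"
    using history_subset[of M M n Y] by (auto simp: subalgebra_def)
  interpret F: finite_measure_subalgebra M "history M Y n" by standard (rule sub)
  have wM[measurable]: "w \<in> borel_measurable M" using measurable_from_subalg[OF sub w(1)] .
  note [measurable] = h(1) u(1)
  have B: "0 \<le> B" using h(2)[of 0] by simp
  have C: "0 \<le> C" using w(2) order_trans by blast
  \<comment> \<open>The width of the levels: the discretisation costs
    \<open>\<epsilon> * C \<le> e\<close>, and the added one avoids division by zero.\<close>
  define \<epsilon> where "\<epsilon> = e / (C + 1)"
  have \<epsilon>: "0 < \<epsilon>" using e C by (simp add: \<epsilon>_def)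
  have \<epsilon>C: "\<epsilon> * C \<le> e" using e C by (simp add: \<epsilon>_def field_simps)
  define J where "J = \<lceil>B / \<epsilon>\<rceil> + 1"
  define A where "A = (\<lambda>j. {x. \<lfloor>h x / \<epsilon>\<rfloor> = j})"
  have A[measurable]: "A j \<in> sets borel" for j unfolding A_def by measurable
  \<comment> \<open>\<open>h\<close> rounded down to a multiple of \<open>\<epsilon>\<close>.
    Boundedness of \<open>h\<close> confines the levels to \<open>{-J..J}\<close>, so
    \<open>s\<close> is a finite combination of indicators.\<close>
  define s where "s = (\<lambda>x. \<Sum>j\<in>{-J..J}. (real_of_int j * \<epsilon>) * indicat_real (A j) x)"
  have s_eq: "s x = real_of_int \<lfloor>h x / \<epsilon>\<rfloor> * \<epsilon>" for x
  proof -
    have "\<bar>h x / \<epsilon>\<bar> \<le> B / \<epsilon>" using h(2)[of x] \<epsilon> by (simp add: divide_right_mono)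
    then have "- (B / \<epsilon>) \<le> h x / \<epsilon>" "h x / \<epsilon> \<le> B / \<epsilon>" by linarith+
    then have "\<lfloor>h x / \<epsilon>\<rfloor> \<in> {-J..J}" unfolding J_def atLeastAtMost_iff by (intro conjI; linarith)
    then show ?thesis
      unfolding s_def
      by (subst sum.cong[OF refl, of _ _ "\<lambda>j. if j = \<lfloor>h x / \<epsilon>\<rfloor> then real_of_int j * \<epsilon> else 0"])
         (auto simp: A_def indicator_def)
  qed
  have s_le: "s x \<le> h x" for x
    unfolding s_eq by (rule iffD1[OF pos_le_divide_eq[OF \<epsilon>] of_int_floor_le])
  have s_ge: "h x - \<epsilon> \<le> s x" for x
  proof -
    have "h x / \<epsilon> - 1 \<le> real_of_int \<lfloor>h x / \<epsilon>\<rfloor>" by linarith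
    from mult_right_mono[OF this, of \<epsilon>] show ?thesis using \<epsilon> by (simp add: s_eq left_diff_distrib)
  qed
  have s_bd: "\<bar>s x\<bar> \<le> B + \<epsilon>" for x using s_le[of x] s_ge[of x] h(2)[of x] \<epsilon> by linarith
  have sm[measurable]: "s \<in> borel_measurable borel" unfolding s_def by measurable
  have wb: "\<bar>w \<omega> * p\<bar> \<le> C * q" if "\<bar>p\<bar> \<le> q" for \<omega> p q
    using w(2)[of \<omega>] that by (auto simp: abs_mult intro: mult_mono)
  let ?CE = "\<lambda>j. real_cond_exp M (history M Y n) (\<lambda>\<omega>. indicat_real (A j) (Y (Suc n) \<omega>))"
  have int1: "integrable M (\<lambda>\<omega>. w \<omega> * indicat_real (A j) (Y (Suc n) \<omega>))" for j
  proof (rule integrable_const_bound[of _ "C * 1"])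
    show "AE \<omega> in M. norm (w \<omega> * indicat_real (A j) (Y (Suc n) \<omega>)) \<le> C * 1"
      unfolding real_norm_def by (intro AE_I2 wb) (simp add: indicator_def)
  qed measurable
  have int2: "integrable M (\<lambda>\<omega>. w \<omega> * ?CE j \<omega>)" and ce: "(\<integral>\<omega>. w \<omega> * ?CE j \<omega> \<partial>M) = (\<integral>\<omega>. w \<omega> * indicat_real (A j) (Y (Suc n) \<omega>) \<partial>M)" for j
    using F.real_cond_exp_intg[OF int1 w(1)] by auto
  \<comment> \<open>There are only finitely many levels, so one null set serves them all.\<close>
  have CE: "AE \<omega> in M. \<forall>j\<in>{-J..J}. ?CE j \<omega> = measure (K (Y n \<omega>)) (A j)"
    using mc A unfolding markov_chain_from_def history_def by (intro AE_finite_allI) auto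
  have "(\<integral>\<omega>. w \<omega> * s (Y (Suc n) \<omega>) \<partial>M) = (\<integral>\<omega>. (\<Sum>j\<in>{-J..J}. (real_of_int j * \<epsilon>) * (w \<omega> * indicat_real (A j) (Y (Suc n) \<omega>))) \<partial>M)"
    by (simp add: s_def sum_distrib_left mult_ac)
  also have "\<dots> = (\<Sum>j\<in>{-J..J}. (real_of_int j * \<epsilon>) * (\<integral>\<omega>. w \<omega> * indicat_real (A j) (Y (Suc n) \<omega>) \<partial>M))"
    using int1 by (subst Bochner_Integration.integral_sum) auto
  also have "\<dots> = (\<Sum>j\<in>{-J..J}. (real_of_int j * \<epsilon>) * (\<integral>\<omega>. w \<omega> * ?CE j \<omega> \<partial>M))"
    by (simp add: ce)
  also have "\<dots> = (\<integral>\<omega>. (\<Sum>j\<in>{-J..J}. (real_of_int j * \<epsilon>) * (w \<omega> * ?CE j \<omega>)) \<partial>M)"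
    using int2 by (subst Bochner_Integration.integral_sum) auto
  also have "\<dots> \<le> (\<integral>\<omega>. w \<omega> * u \<omega> \<partial>M)"
  proof (rule integral_mono_AE)
    show "integrable M (\<lambda>\<omega>. \<Sum>j\<in>{-J..J}. (real_of_int j * \<epsilon>) * (w \<omega> * ?CE j \<omega>))" using int2 by auto
    show "integrable M (\<lambda>\<omega>. w \<omega> * u \<omega>)"
      by (rule integrable_const_bound[of _ "C * B'"]) (auto intro!: wb u)
    show "AE \<omega> in M. (\<Sum>j\<in>{-J..J}. (real_of_int j * \<epsilon>) * (w \<omega> * ?CE j \<omega>)) \<le> w \<omega> * u \<omega>"
      using CE le
    proof eventually_elim
      case (elim \<omega>)
      interpret K: prob_space "K (Y n \<omega>)" by (rule K)
      note [measurable_cong] = K(2)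
      have "(\<Sum>j\<in>{-J..J}. (real_of_int j * \<epsilon>) * ?CE j \<omega>) = (\<integral>z. s z \<partial>K (Y n \<omega>))"
        unfolding s_def using elim(1)
        by (subst Bochner_Integration.integral_sum) (auto simp: K(2) intro!: sum.cong K.integrable_const_bound[of _ 1])
      also have "\<dots> \<le> (\<integral>z. h z \<partial>K (Y n \<omega>))"
      proof (rule integral_mono)
        show "integrable (K (Y n \<omega>)) s" by (rule K.integrable_const_bound[of _ "B + \<epsilon>"]) (auto simp: s_bd)
        show "integrable (K (Y n \<omega>)) h" by (rule K.integrable_const_bound[of _ B]) (auto simp: h)
      qed (rule s_le)
      finally have "(\<Sum>j\<in>{-J..J}. (real_of_int j * \<epsilon>) * ?CE j \<omega>) \<le> u \<omega>" using elim(2) by linarith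
      then have "w \<omega> * (\<Sum>j\<in>{-J..J}. (real_of_int j * \<epsilon>) * ?CE j \<omega>) \<le> w \<omega> * u \<omega>"
        using w(2) by (intro mult_left_mono) auto
      then show ?case by (simp add: sum_distrib_left mult_ac)
    qed
  qed
  finally have 1: "(\<integral>\<omega>. w \<omega> * s (Y (Suc n) \<omega>) \<partial>M) \<le> (\<integral>\<omega>. w \<omega> * u \<omega> \<partial>M)" .
  have "(\<integral>\<omega>. w \<omega> * h (Y (Suc n) \<omega>) \<partial>M) \<le> (\<integral>\<omega>. w \<omega> * s (Y (Suc n) \<omega>) + \<epsilon> * C \<partial>M)"
  proof (rule integral_mono)
    show "integrable M (\<lambda>\<omega>. w \<omega> * h (Y (Suc n) \<omega>))"
      by (rule integrable_const_bound[of _ "C * B"]) (auto intro!: wb h)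
    have "integrable M (\<lambda>\<omega>. w \<omega> * s (Y (Suc n) \<omega>))"
      by (rule integrable_const_bound[of _ "C * (B + \<epsilon>)"]) (auto intro!: wb s_bd)
    then show "integrable M (\<lambda>\<omega>. w \<omega> * s (Y (Suc n) \<omega>) + \<epsilon> * C)" by simp
    fix \<omega>
    have "w \<omega> * (h (Y (Suc n) \<omega>) - s (Y (Suc n) \<omega>)) \<le> C * \<epsilon>"
      using w(2)[of \<omega>] s_ge[of "Y (Suc n) \<omega>"] s_le[of "Y (Suc n) \<omega>"] by (intro mult_mono) auto
    then show "w \<omega> * h (Y (Suc n) \<omega>) \<le> w \<omega> * s (Y (Suc n) \<omega>) + \<epsilon> * C" by (simp add: algebra_simps)
  qed
  also have "\<dots> = (\<integral>\<omega>. w \<omega> * s (Y (Suc n) \<omega>) \<partial>M) + \<epsilon> * C"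
    by (subst Bochner_Integration.integral_add)
       (auto simp: prob_space intro!: integrable_const_bound[of _ "C * (B + \<epsilon>)"] wb s_bd)
  finally show "(\<integral>\<omega>. w \<omega> * h (Y (Suc n) \<omega>) \<partial>M) \<le> (\<integral>\<omega>. w \<omega> * u \<omega> \<partial>M) + e" using 1 \<epsilon>C by linarith
qed

text \<open>Tietze's theorem reconciles functions given on \<open>closure D\<close> or
  \<open>frontier D\<close> with the estimates above, which ask for bounded continuous functions on
  the whole space.\<close>

lemma bounded_continuous_extension:
  fixes q :: "'a::euclidean_space \<Rightarrow> real"
  assumes "compact S" "continuous_on S q"
  obtains p B where "continuous_on UNIV p" "\<And>x. \<bar>p x\<bar> \<le> B" "\<And>x. x \<in> S \<Longrightarrow> p x = q x"
proof -
  have "bounded (q ` S)" using assms by (intro compact_imp_bounded compact_continuous_image)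
  then obtain B where B: "\<And>x. x \<in> S \<Longrightarrow> norm (q x) \<le> B" unfolding bounded_iff by blast
  have "\<And>x. x \<in> S \<Longrightarrow> norm (q x) \<le> max 0 B" using B by (simp add: le_max_iff_disj)
  then obtain p where "continuous_on UNIV p" "\<And>x. x \<in> S \<Longrightarrow> p x = q x" "\<And>x. norm (p x) \<le> max 0 B"
    using Tietze[OF assms(2), of UNIV "max 0 B"] compact_imp_closed[OF assms(1)] by auto
  then show thesis using that by auto
qed

lemma convergent_if_coordinates:
  fixes y :: "nat \<Rightarrow> 'a::euclidean_space"
  assumes "\<And>i. i \<in> Basis \<Longrightarrow> convergent (\<lambda>n. y n \<bullet> i)"
  shows "convergent y"
proof -
  have "(\<lambda>n. \<Sum>i\<in>Basis. (y n \<bullet> i) *\<^sub>R i) \<longlonglongrightarrow> (\<Sum>i\<in>Basis. lim (\<lambda>n. y n \<bullet> i) *\<^sub>R i)"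
    using assms by (intro tendsto_sum tendsto_scaleR tendsto_const) (simp add: convergent_LIMSEQ_iff)
  then show ?thesis by (simp add: euclidean_representation convergent_def) blast
qed

text \<open>Near \<open>v\<close> continuity of \<open>f\<close> suffices. Away from
  \<open>v\<close> the barrier has a positive minimum on a compact set, and a multiple of
  \<open>q\<close> dominates twice the bound of \<open>f\<close>.\<close>

lemma abs_diff_le_barrier:
  fixes f q :: "'a::euclidean_space \<Rightarrow> real"
  assumes S: "compact S" "v \<in> S" and f: "continuous_on S f" and q: "continuous_on S q"
    and qv: "q v = 0" and qpos: "\<And>w. w \<in> S \<Longrightarrow> w \<noteq> v \<Longrightarrow> 0 < q w" and e: "0 < e"
  obtains C where "0 \<le> C" "\<And>w. w \<in> S \<Longrightarrow> \<bar>f w - f v\<bar> \<le> e + C * q w"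
proof -
  have q0: "0 \<le> q w" if "w \<in> S" for w using qv qpos[OF that] by (cases "w = v") auto
  obtain d where d: "0 < d" "\<And>w. w \<in> S \<Longrightarrow> dist w v < d \<Longrightarrow> dist (f w) (f v) < e"
    using f S(2) e unfolding continuous_on_iff by meson
  have "bounded (f ` S)" using S f by (intro compact_imp_bounded compact_continuous_image)
  then obtain B where B: "\<And>x. x \<in> S \<Longrightarrow> \<bar>f x\<bar> \<le> B" unfolding bounded_iff by auto
  have B0: "0 \<le> B" using B[OF S(2)] by linarith
  have T: "compact (S - ball v d)" using S by (intro compact_diff) auto
  show thesis
  proof (cases "S - ball v d = {}")
    case True
    show thesis
    proof (rule that[of 0])
      fix w assume "w \<in> S"
      then show "\<bar>f w - f v\<bar> \<le> e + 0 * q w" using True d(2)[of w] by (auto simp: dist_real_def dist_commute)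
    qed simp
  next
    case False
    have "continuous_on (S - ball v d) q" using q by (rule continuous_on_subset) auto
    then obtain u where u: "u \<in> S - ball v d" "\<And>w. w \<in> S - ball v d \<Longrightarrow> q u \<le> q w"
      using continuous_attains_inf[OF T False] by blast
    have m: "0 < q u" using u d(1) by (intro qpos) auto
    show thesis
    proof (rule that[of "2 * B / q u"])
      show "0 \<le> 2 * B / q u" using B0 m by simp
      fix w assume w: "w \<in> S"
      show "\<bar>f w - f v\<bar> \<le> e + 2 * B / q u * q w"
      proof (cases "w \<in> ball v d")
        case True
        then have "\<bar>f w - f v\<bar> < e" using d(2)[OF w] by (auto simp: dist_real_def dist_commute)
        moreover have "0 \<le> 2 * B / q u * q w" using B0 m q0[OF w] by simp
        ultimately show ?thesis by linarith
      next
        case False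
        then have "q u \<le> q w" using u(2) w by auto
        then have "2 * B * 1 \<le> 2 * B * (q w / q u)" using B0 m by (intro mult_left_mono) auto
        then show ?thesis using B[OF w] B[OF S(2)] e by simp
      qed
    qed
  qed
qed

section \<open>Stability of supersolutions and the exponential examples\<close>

context drifted_brownian_motion
begin

lemma supersolution_subset: "supersolution D h \<Longrightarrow> D' \<subseteq> D \<Longrightarrow> supersolution D' h"
proof -
  assume sup: "supersolution D h" and sub: "D' \<subseteq> D"
  obtain g H where gH: "C2_on D h g H"
    and L: "\<forall>x\<in>D. a * (\<Sum>i\<in>Basis. blinfun_apply (H x) i \<bullet> i) + b \<bullet> g x \<le> 0"
    using sup by (auto simp: supersolution_def)
  have "C2_on D' h g H"
    using gH sub continuous_on_subset[OF _ sub, of H] by (auto simp: C2_on_def)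
  then show ?thesis using L sub unfolding supersolution_def by blast
qed

lemma supersolution_cong:
  assumes D: "open D" and eq: "\<And>x. x \<in> D \<Longrightarrow> h x = h' x" and sup: "supersolution D h"
  shows "supersolution D h'"
proof -
  obtain g H where gH: "C2_on D h g H"
    and L: "\<forall>x\<in>D. a * (\<Sum>i\<in>Basis. blinfun_apply (H x) i \<bullet> i) + b \<bullet> g x \<le> 0"
    using sup by (auto simp: supersolution_def)
  have "GDERIV h' x :> g x" if x: "x \<in> D" for x
  proof -
    have "(h has_derivative (\<lambda>k. k \<bullet> g x)) (at x)" using gH x by (simp add: C2_on_def gderiv_def)
    from has_derivative_transform_within_open[OF this D x eq] show ?thesis by (simp add: gderiv_def)
  qed
  then have "C2_on D h' g H" using gH by (simp add: C2_on_def)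
  then show ?thesis using L unfolding supersolution_def by blast
qed

text \<open>
  These functions make the exponentials of the coordinates of the chain bounded submartingales; the
  drift prevents the use of the coordinates themselves.
\<close>

lemma supersolution_minus_exp:
  assumes i: "i \<in> Basis" and k: "norm b / a \<le> k"
  shows "supersolution D (\<lambda>x. - exp (k * (x \<bullet> i)))"
proof -
  define Q where "Q = Blinfun (\<lambda>v::'a. (v \<bullet> i) *\<^sub>R i)"
  have "bounded_linear (\<lambda>v::'a. (v \<bullet> i) *\<^sub>R i)"
    by (intro bounded_linear_compose[OF bounded_linear_scaleR_left bounded_linear_inner_left])
  then have Q: "blinfun_apply Q v = (v \<bullet> i) *\<^sub>R i" for v
    unfolding Q_def by (simp add: bounded_linear_Blinfun_apply)
  define g where "g = (\<lambda>x::'a. (- k * exp (k * (x \<bullet> i))) *\<^sub>R i)"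
  define H where "H = (\<lambda>x::'a. (- k\<^sup>2 * exp (k * (x \<bullet> i))) *\<^sub>R Q)"
  have H: "blinfun_apply (H x) v = (- k\<^sup>2 * exp (k * (x \<bullet> i)) * (v \<bullet> i)) *\<^sub>R i" for x v
    by (simp add: H_def Q blinfun.scaleR_left blinfun.minus_left)
  have k0: "0 \<le> k" using k a_pos order_trans[OF _ k, of 0] by simp
  have "C2_on D (\<lambda>x. - exp (k * (x \<bullet> i))) g H"
    unfolding C2_on_def gderiv_def
  proof (intro conjI ballI)
    fix x :: 'a
    show "((\<lambda>x. - exp (k * (x \<bullet> i))) has_derivative (\<lambda>h. h \<bullet> g x)) (at x)"
      by (auto intro!: derivative_eq_intros simp: g_def)
    show "(g has_derivative blinfun_apply (H x)) (at x)"
      unfolding g_def by (auto intro!: derivative_eq_intros simp: H power2_eq_square fun_eq_iff)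
    show "continuous_on D H" unfolding H_def by (intro continuous_intros)
  qed
  moreover have "a * (\<Sum>j\<in>Basis. blinfun_apply (H x) j \<bullet> j) + b \<bullet> g x \<le> 0" for x
  proof -
    have "(\<Sum>j\<in>Basis. blinfun_apply (H x) j \<bullet> j) = - k\<^sup>2 * exp (k * (x \<bullet> i))"
      using i by (subst sum.cong[OF refl, of _ _ "\<lambda>j. if j = i then - k\<^sup>2 * exp (k * (x \<bullet> i)) else 0"])
         (auto simp: H inner_Basis)
    \<comment> \<open>Here the size of \<open>k\<close> enters: the second-order term
      \<open>a * k\<close> outweighs the component of the drift against direction
      \<open>i\<close>.\<close>
    moreover have "- (b \<bullet> i) \<le> a * k"
    proof -
      have "- (b \<bullet> i) \<le> norm b" using Basis_le_norm[OF i, of b] by linarith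
      also have "\<dots> \<le> a * k" using k a_pos by (simp add: pos_divide_le_eq mult.commute)
      finally show ?thesis .
    qed
    ultimately have "a * (\<Sum>j\<in>Basis. blinfun_apply (H x) j \<bullet> j) + b \<bullet> g x
        = - (k * exp (k * (x \<bullet> i)) * (a * k + b \<bullet> i))"
      by (simp add: g_def power2_eq_square algebra_simps)
    moreover have "0 \<le> k * exp (k * (x \<bullet> i)) * (a * k + b \<bullet> i)"
      using k0 \<open>- (b \<bullet> i) \<le> a * k\<close> by simp
    ultimately show ?thesis by linarith
  qed
  ultimately show ?thesis unfolding supersolution_def by blast
qed

end

section \<open>The one-step kernel of a bounded open set\<close>

locale exit_kernel = drifted_brownian_motion M W a \<sigma> b
  for M :: "'w measure" and W :: "real \<Rightarrow> 'w \<Rightarrow> 'a::euclidean_space" and a \<sigma> :: real and b :: 'a +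
  fixes \<theta> :: real and D :: "'a set"
  assumes \<theta>: "0 < \<theta>" "\<theta> \<le> 1" and D: "D \<noteq> {}" "bounded D" "open D"
begin

abbreviation K :: "'a \<Rightarrow> 'a measure" where "K \<equiv> transition_law M b \<sigma> W \<theta> D"

abbreviation radius :: "'a \<Rightarrow> real" where "radius y \<equiv> \<theta> * infdist y (frontier D)"

lemma frontier_nonempty: "frontier D \<noteq> {}"
  using D not_bounded_UNIV by (metis frontier_eq_empty)

lemma radius_nonneg: "0 \<le> radius y"
  using \<theta> by (simp add: infdist_nonneg)

lemma radius_pos:
  assumes "y \<in> D"
  shows "0 < radius y"
proof -
  have "y \<notin> frontier D" using assms D(3) by (simp add: frontier_def interior_open)
  then have "0 < infdist y (frontier D)"
    by (rule infdist_pos_not_in_closed[OF frontier_closed frontier_nonempty])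
  then show ?thesis using \<theta> by simp
qed

text \<open>A connected set that meets \<open>D\<close> without being contained in it meets the
  frontier, but frontier points are at distance at least \<open>infdist y (frontier D)\<close>,
  which \<open>\<theta> \<le> 1\<close> keeps above the radius. For \<open>y\<close> on the frontier
  the ball is empty.\<close>

lemma ball_radius_subset:
  assumes y: "y \<in> closure D"
  shows "ball y (radius y) \<subseteq> D"
proof (cases "y \<in> D")
  case False
  then have "y \<in> frontier D" using y D by (simp add: frontier_def interior_open)
  then show ?thesis by (simp add: infdist_zero)
next
  case True
  show ?thesis
  proof (rule ccontr)
    assume "\<not> ball y (radius y) \<subseteq> D"
    then have "ball y (radius y) - D \<noteq> {}" by blast
    moreover have "ball y (radius y) \<inter> D \<noteq> {}" using True radius_pos[OF True] centre_in_ball by blast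
    ultimately obtain z where z: "z \<in> ball y (radius y)" "z \<in> frontier D"
      using connected_Int_frontier[OF connected_ball, of y "radius y" D] by blast
    have "infdist y (frontier D) \<le> dist y z" by (rule infdist_le[OF z(2)])
    moreover have "radius y \<le> infdist y (frontier D)"
      using \<theta> mult_right_mono[of \<theta> 1 "infdist y (frontier D)"] by (simp add: infdist_nonneg)
    ultimately show False using z(1) by auto
  qed
qed

lemma K_measurable [measurable]: "exit_point b \<sigma> W y (radius y) \<in> borel_measurable M"
  by (rule exit_point_measurable[OF radius_nonneg])

lemma K_prob_space: "prob_space (K y)"
  unfolding transition_law_def by (rule prob_space_distr) (rule K_measurable)

lemma K_sets: "sets (K y) = sets borel"
  by (simp add: transition_law_def)

lemma K_integral:
  fixes h :: "'a \<Rightarrow> real"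
  assumes [measurable]: "h \<in> borel_measurable borel"
  shows "(\<integral>z. h z \<partial>K y) = (\<integral>\<omega>. h (exit_point b \<sigma> W y (radius y) \<omega>) \<partial>M)"
  unfolding transition_law_def by (rule integral_distr) measurable

lemma exit_point_dist_AE: "AE \<omega> in M. dist y (exit_point b \<sigma> W y (radius y) \<omega>) = radius y"
proof (cases "radius y = 0")
  case True
  then show ?thesis using AE_space by (auto simp: exit_point_zero)
next
  case False
  then have "0 < radius y" using radius_nonneg[of y] by linarith
  from exit_point_AE[OF this, of y] show ?thesis by eventually_elim simp
qed

lemma exit_point_closure_AE:
  assumes y: "y \<in> closure D"
  shows "AE \<omega> in M. exit_point b \<sigma> W y (radius y) \<omega> \<in> closure D"
  using exit_point_dist_AE[of y]
proof eventually_elim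
  case (elim \<omega>)
  show ?case
  proof (cases "radius y = 0")
    case True
    then have "exit_point b \<sigma> W y (radius y) \<omega> = y" using elim by (metis dist_eq_0_iff)
    then show ?thesis using y by (simp only:)
  next
    case False
    then have "0 < radius y" using radius_nonneg[of y] by linarith
    then have "cball y (radius y) = closure (ball y (radius y))" by (rule closure_ball[symmetric])
    then show ?thesis using elim closure_mono[OF ball_radius_subset[OF y]] by auto
  qed
qed

section \<open>The chain started at a point of the domain\<close>

context
  fixes x :: 'a and Y :: "nat \<Rightarrow> 'w \<Rightarrow> 'a"
  assumes x: "x \<in> D" and mc: "markov_chain_from M K x Y"
begin

lemma Y_measurable [measurable]: "Y n \<in> borel_measurable M"
  using mc by (simp add: markov_chain_from_def)

lemma Y_0: "\<omega> \<in> space M \<Longrightarrow> Y 0 \<omega> = x"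
  using mc by (simp add: markov_chain_from_def)

lemmas step_le = markov_chain_step_le[OF prob_space_axioms mc K_prob_space K_sets]

lemma Y_closure_AE: "AE \<omega> in M. \<forall>n. Y n \<omega> \<in> closure D"
proof (subst AE_all_countable, rule allI)
  fix n
  show "AE \<omega> in M. Y n \<omega> \<in> closure D"
  proof (induction n)
    case 0
    show ?case using AE_space x closure_subset[of D] by (auto simp: Y_0)
  next
    case (Suc n)
    let ?h = "indicat_real (- closure D)"
    \<comment> \<open>The one-step inequality with weight 1 and the indicator of the complement of
      \<open>closure D\<close>: its mean under the kernel is zero from any point of
      \<open>closure D\<close>.\<close>
    have "(\<integral>\<omega>. 1 * ?h (Y (Suc n) \<omega>) \<partial>M) \<le> (\<integral>\<omega>. 1 * (0::real) \<partial>M)"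
    proof (rule step_le[where B=1 and C=1 and B'=0])
      show "AE \<omega> in M. (\<integral>z. ?h z \<partial>K (Y n \<omega>)) \<le> 0"
        using Suc
      proof eventually_elim
        case (elim \<omega>)
        have "(\<integral>\<omega>'. ?h (exit_point b \<sigma> W (Y n \<omega>) (radius (Y n \<omega>)) \<omega>') \<partial>M) = (\<integral>\<omega>'. 0 \<partial>M)"
          by (rule integral_cong_AE) (use exit_point_closure_AE[OF elim] in auto)
        then show ?case by (subst K_integral) auto
      qed
    qed (auto split: split_indicator)
    also have "(\<integral>\<omega>. 1 * ?h (Y (Suc n) \<omega>) \<partial>M) = prob {\<omega>\<in>space M. Y (Suc n) \<omega> \<in> - closure D}"
      by (subst Bochner_Integration.integral_cong[OF refl, of _ _ "indicat_real {\<omega>\<in>space M. Y (Suc n) \<omega> \<in> - closure D}"])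
         (auto simp: indicator_def intro!: arg_cong[where f=prob])
    finally have "prob {\<omega>\<in>space M. Y (Suc n) \<omega> \<in> - closure D} \<le> 0" by simp
    then have "prob {\<omega>\<in>space M. Y (Suc n) \<omega> \<in> - closure D} = 0"
      by (rule order_antisym) (rule measure_nonneg)
    moreover have "closure D \<in> sets borel" by simp
    then have "{\<omega>\<in>space M. Y (Suc n) \<omega> \<in> - closure D} \<in> sets M" by measurable
    ultimately have "AE \<omega> in M. \<omega> \<notin> {\<omega>\<in>space M. Y (Suc n) \<omega> \<in> - closure D}" using prob_eq_0 by blast
    then show ?case using AE_space by eventually_elim simp
  qed
qed

text \<open>The supermartingale property of \<open>h (Y n)\<close>, tested against bounded
  nonnegative functions \<open>w\<close> of the past. It applies because the ball around each
  position lies inside \<open>D\<close>.\<close>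

lemma Y_supersolution:
  assumes sup: "supersolution D h" and h: "continuous_on UNIV h" "\<And>x. \<bar>h x\<bar> \<le> B"
    and w: "w \<in> borel_measurable (history M Y n)" "\<And>\<omega>. 0 \<le> w \<omega> \<and> w \<omega> \<le> C"
  shows "(\<integral>\<omega>. w \<omega> * h (Y (Suc n) \<omega>) \<partial>M) \<le> (\<integral>\<omega>. w \<omega> * h (Y n \<omega>) \<partial>M)"
proof -
  have [measurable]: "h \<in> borel_measurable borel" using h(1) by (rule borel_measurable_continuous_onI)
  show ?thesis
  proof (rule step_le[OF _ h(2) w])
    show "AE \<omega> in M. (\<integral>z. h z \<partial>K (Y n \<omega>)) \<le> h (Y n \<omega>)"
      using Y_closure_AE
    proof eventually_elim
      case (elim \<omega>)
      show ?case
        using elim by (subst K_integral)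
          (auto intro!: exit_point_supersolution[OF supersolution_subset[OF sup] h] ball_radius_subset radius_nonneg)
    qed
  qed (auto intro: h(2))
qed

lemma Y_coordinate_convergent:
  assumes i: "i \<in> Basis"
  shows "AE \<omega> in M. convergent (\<lambda>n. Y n \<omega> \<bullet> i)"
proof -
  \<comment> \<open>Both \<open>k\<close> and \<open>2 * k\<close> must dominate
    \<open>norm b / a\<close>, for the exponential and for its square; the added one keeps
    \<open>k\<close> positive even when \<open>b = 0\<close>, as the final division by
    \<open>k\<close> requires.\<close>
  define k where "k = norm b / a + 1"
  have k: "norm b / a \<le> k" "norm b / a \<le> 2 * k" "0 < k"
    using divide_nonneg_pos[OF norm_ge_zero a_pos, of b] by (auto simp: k_def)
  have cpt: "compact (closure D)" using D by simp
  obtain p B where p: "continuous_on UNIV p" "\<And>z. \<bar>p z\<bar> \<le> B" "\<And>z. z \<in> closure D \<Longrightarrow> p z = exp (k * (z \<bullet> i))"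
    by (rule bounded_continuous_extension[OF cpt, of "\<lambda>z. exp (k * (z \<bullet> i))"]) (auto intro!: continuous_intros)
  \<comment> \<open>The extension may be negative off \<open>closure D\<close>; truncation restores
    the pointwise nonnegativity asked for by the convergence lemma.\<close>
  define P where "P = (\<lambda>z. max 0 (p z))"
  have P: "continuous_on UNIV P" "\<And>z. 0 \<le> P z \<and> P z \<le> B" "\<And>z. z \<in> closure D \<Longrightarrow> P z = exp (k * (z \<bullet> i))"
    using p p(2)[THEN order_trans[OF abs_ge_zero]] p(2)[THEN order_trans[OF abs_ge_self]]
    by (auto simp: P_def intro!: continuous_intros)
  have P2: "\<bar>- (P z)\<^sup>2\<bar> \<le> B\<^sup>2" "\<bar>- P z\<bar> \<le> B" for z using P(2)[of z] by (auto intro: power_mono)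
  have PD: "P z = exp (k * (z \<bullet> i))" if "z \<in> D" for z using P(3) that closure_subset by blast
  have sup1: "supersolution D (\<lambda>z. - P z)"
    by (rule supersolution_cong[OF D(3) _ supersolution_minus_exp[OF i k(1)]]) (simp add: PD)
  have sup2: "supersolution D (\<lambda>z. - (P z)\<^sup>2)"
    by (rule supersolution_cong[OF D(3) _ supersolution_minus_exp[OF i k(2)]])
       (simp add: PD power2_eq_square flip: exp_add)
  have "AE \<omega> in M. convergent (\<lambda>n. P (Y n \<omega>))"
  proof (rule bounded_submartingale_converges[where F="history M Y" and C=B])
    have Pm[measurable]: "P \<in> borel_measurable borel" using P(1) by (rule borel_measurable_continuous_onI)
    show "subalgebra M (history M Y n)" for n
      using history_subset[of M M n Y] by (auto simp: subalgebra_def)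
    show "sets (history M Y m) \<subseteq> sets (history M Y n)" if "m \<le> n" for m n
      using that by (intro history_subset) (auto intro: history_measurable)
    show "(\<lambda>\<omega>. P (Y n \<omega>)) \<in> borel_measurable (history M Y n)" for n
      using measurable_compose[OF history_measurable[OF order_refl, of Y n M] Pm] .
    show "0 \<le> P (Y n \<omega>) \<and> P (Y n \<omega>) \<le> B" for n \<omega> by (rule P(2))
    fix n and w :: "'w \<Rightarrow> real" and C :: real assume w: "w \<in> borel_measurable (history M Y n)" "\<And>\<omega>. 0 \<le> w \<omega> \<and> w \<omega> \<le> C"
    show "(\<integral>\<omega>. w \<omega> * P (Y n \<omega>) \<partial>M) \<le> (\<integral>\<omega>. w \<omega> * P (Y (Suc n) \<omega>) \<partial>M)"
      using Y_supersolution[OF sup1 _ P2(2) w] P(1) by (simp add: continuous_on_minus)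
    show "(\<integral>\<omega>. w \<omega> * (P (Y n \<omega>))\<^sup>2 \<partial>M) \<le> (\<integral>\<omega>. w \<omega> * (P (Y (Suc n) \<omega>))\<^sup>2 \<partial>M)"
      using Y_supersolution[OF sup2 _ P2(1) w] P(1) by (simp add: continuous_on_minus continuous_on_power)
  qed
  then show ?thesis using Y_closure_AE
  proof eventually_elim
    case (elim \<omega>)
    obtain R where R: "\<And>z. z \<in> closure D \<Longrightarrow> norm z \<le> R"
      using compact_imp_bounded[OF cpt] by (auto simp: bounded_iff)
    obtain l where "(\<lambda>n. P (Y n \<omega>)) \<longlonglongrightarrow> l" using elim(1) by (auto simp: convergent_def)
    then have l: "(\<lambda>n. exp (k * (Y n \<omega> \<bullet> i))) \<longlonglongrightarrow> l" using elim(2) P(3) by simp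
    \<comment> \<open>Boundedness of \<open>D\<close> keeps the limit away from 0, so the logarithm
      recovers convergence of the coordinate itself.\<close>
    have "exp (k * - R) \<le> exp (k * (Y n \<omega> \<bullet> i))" for n
    proof -
      have "\<bar>Y n \<omega> \<bullet> i\<bar> \<le> R" using Basis_le_norm[OF i, of "Y n \<omega>"] R[of "Y n \<omega>"] elim(2) by force
      then have "- R \<le> Y n \<omega> \<bullet> i" by linarith
      then have "k * - R \<le> k * (Y n \<omega> \<bullet> i)" using k by (intro mult_left_mono) auto
      then show ?thesis by (simp only: exp_le_cancel_iff)
    qed
    then have "exp (k * - R) \<le> l" by (intro LIMSEQ_le_const[OF l]) auto
    then have "l \<noteq> 0" using exp_gt_zero[of "k * - R"] by linarith
    from tendsto_divide[OF tendsto_ln[OF l this] tendsto_const[of k]] k(3)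
    show ?case by (auto simp: convergent_def)
  qed
qed

text \<open>
  The exit point lies on the sphere, hence outside \<open>U\<close>. Sets of this kind form a neighbourhood base of
  every point of \<open>D\<close>, which excludes limits inside \<open>D\<close>.
\<close>

lemma Y_leaves_AE:
  assumes U: "open U" "U \<subseteq> D" "\<And>y. y \<in> U \<Longrightarrow> U \<subseteq> ball y (radius y)"
  shows "AE \<omega> in M. \<forall>n. \<not> (Y n \<omega> \<in> U \<and> Y (Suc n) \<omega> \<in> U)"
proof (subst AE_all_countable, rule allI)
  fix n
  have [measurable]: "U \<in> sets borel" using U(1) by simp
  \<comment> \<open>Weight: the indicator of \<open>Y n \<in> U\<close>. The upper bound for the
    kernel mean is 0 on \<open>U\<close> and the trivial 1 elsewhere, so its product with the weight
    vanishes.\<close>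
  have "(\<integral>\<omega>. indicat_real U (Y n \<omega>) * indicat_real U (Y (Suc n) \<omega>) \<partial>M)
      \<le> (\<integral>\<omega>. indicat_real U (Y n \<omega>) * indicat_real (- U) (Y n \<omega>) \<partial>M)"
  proof (rule step_le[where B=1 and C=1 and B'=1])
    show "(\<lambda>\<omega>. indicat_real U (Y n \<omega>)) \<in> borel_measurable (history M Y n)"
      by (rule measurable_compose[OF history_measurable[OF order_refl]]) simp
    show "AE \<omega> in M. (\<integral>z. indicat_real U z \<partial>K (Y n \<omega>)) \<le> indicat_real (- U) (Y n \<omega>)"
    proof (rule AE_I2)
      fix \<omega>
      show "(\<integral>z. indicat_real U z \<partial>K (Y n \<omega>)) \<le> indicat_real (- U) (Y n \<omega>)"
      proof (cases "Y n \<omega> \<in> U")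
        case True
        have "(\<integral>\<omega>'. indicat_real U (exit_point b \<sigma> W (Y n \<omega>) (radius (Y n \<omega>)) \<omega>') \<partial>M) = (\<integral>\<omega>'. 0 \<partial>M)"
        proof (rule integral_cong_AE)
          show "AE \<omega>' in M. indicat_real U (exit_point b \<sigma> W (Y n \<omega>) (radius (Y n \<omega>)) \<omega>') = 0"
            using exit_point_dist_AE[of "Y n \<omega>"]
          proof eventually_elim
            case (elim \<omega>')
            then have "exit_point b \<sigma> W (Y n \<omega>) (radius (Y n \<omega>)) \<omega>' \<notin> ball (Y n \<omega>) (radius (Y n \<omega>))" by simp
            then show ?case using U(3)[OF True] by (auto simp: indicator_def)
          qed
        qed auto
        then show ?thesis by (subst K_integral) auto
      next
        case False
        interpret K: prob_space "K (Y n \<omega>)" by (rule K_prob_space)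
        show ?thesis using False by (simp add: K_sets)
      qed
    qed
  qed (auto split: split_indicator)
  also have "(\<lambda>\<omega>. indicat_real U (Y n \<omega>) * indicat_real (- U) (Y n \<omega>)) = (\<lambda>_. 0)"
    by (auto split: split_indicator)
  also have "(\<integral>\<omega>. indicat_real U (Y n \<omega>) * indicat_real U (Y (Suc n) \<omega>) \<partial>M)
     = prob {\<omega>\<in>space M. Y n \<omega> \<in> U \<and> Y (Suc n) \<omega> \<in> U}"
    by (subst Bochner_Integration.integral_cong[OF refl, of _ _ "indicat_real {\<omega>\<in>space M. Y n \<omega> \<in> U \<and> Y (Suc n) \<omega> \<in> U}"])
       (auto simp: indicator_def)
  finally have "prob {\<omega>\<in>space M. Y n \<omega> \<in> U \<and> Y (Suc n) \<omega> \<in> U} \<le> 0" by simp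
  then have "prob {\<omega>\<in>space M. Y n \<omega> \<in> U \<and> Y (Suc n) \<omega> \<in> U} = 0"
    by (rule order_antisym) (rule measure_nonneg)
  then show "AE \<omega> in M. \<not> (Y n \<omega> \<in> U \<and> Y (Suc n) \<omega> \<in> U)"
    by (subst (asm) prob_eq_0) auto
qed

lemma Y_converges_AE: "AE \<omega> in M. convergent (\<lambda>n. Y n \<omega>) \<and> lim (\<lambda>n. Y n \<omega>) \<in> frontier D"
proof -
  \<comment> \<open>Each neighbourhood has its own exceptional null set; drawing them from a
    countable base keeps the union null.\<close>
  obtain \<B> :: "'a set set" where \<B>: "countable \<B>" "topological_basis \<B>"
    using ex_countable_basis by blast
  define \<U> where "\<U> = {U\<in>\<B>. U \<subseteq> D \<and> (\<forall>y\<in>U. U \<subseteq> ball y (radius y))}"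
  have "countable \<U>" using \<B>(1) unfolding \<U>_def by auto
  moreover have "AE \<omega> in M. \<forall>n. \<not> (Y n \<omega> \<in> U \<and> Y (Suc n) \<omega> \<in> U)" if "U \<in> \<U>" for U
    using that topological_basis_open[OF \<B>(2)] by (intro Y_leaves_AE) (auto simp: \<U>_def)
  ultimately have leave: "AE \<omega> in M. \<forall>U\<in>\<U>. \<forall>n. \<not> (Y n \<omega> \<in> U \<and> Y (Suc n) \<omega> \<in> U)"
    by (simp add: AE_ball_countable)
  have "AE \<omega> in M. \<forall>i\<in>Basis. convergent (\<lambda>n. Y n \<omega> \<bullet> i)"
    by (intro AE_finite_allI Y_coordinate_convergent) auto
  then show ?thesis using leave Y_closure_AE
  proof eventually_elim
    case (elim \<omega>)
    have conv: "convergent (\<lambda>n. Y n \<omega>)" 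
      by (rule convergent_if_coordinates) (use elim(1) in blast)
    define l where "l = lim (\<lambda>n. Y n \<omega>)"
    have l: "(\<lambda>n. Y n \<omega>) \<longlonglongrightarrow> l" using conv by (simp add: l_def convergent_LIMSEQ_iff)
    have "l \<in> closure D" using closed_sequentially[OF closed_closure _ l] elim(3) by auto
    moreover have "l \<notin> D"
    proof
      assume lD: "l \<in> D"
      \<comment> \<open>Two points of \<open>ball l d\<close> are less than \<open>2 * d\<close>
        apart, while \<open>\<theta> \<le> 1\<close> makes the radius 1-Lipschitz and hence at least
        \<open>3 * d\<close> there; a quarter therefore leaves room.\<close>
      define d where "d = radius l / 4"
      have d: "0 < d" using radius_pos[OF lD] by (simp add: d_def)
      have "open (ball l d \<inter> D)" "l \<in> ball l d \<inter> D" using D d lD by auto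
      then obtain U where U: "U \<in> \<B>" "l \<in> U" "U \<subseteq> ball l d \<inter> D"
        using topological_basisE[OF \<B>(2)] by metis
      have "U \<subseteq> ball y (radius y)" if y: "y \<in> U" for y
      proof
        fix z assume z: "z \<in> U"
        have yd: "dist l y < d" and zd: "dist l z < d" using y z U(3) by auto
        have "dist y z < 2 * d" using dist_triangle[of y z l] yd zd by (simp add: dist_commute)
        moreover have "radius l \<le> radius y + d"
        proof -
          have "infdist l (frontier D) \<le> infdist y (frontier D) + dist l y" by (rule infdist_triangle)
          then have "radius l \<le> \<theta> * (infdist y (frontier D) + dist l y)" using \<theta> by (intro mult_left_mono) auto
          also have "\<theta> * dist l y \<le> 1 * d" using \<theta> yd by (intro mult_mono) auto
          then have "\<theta> * (infdist y (frontier D) + dist l y) \<le> radius y + d" by (simp add: distrib_left)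
          finally show ?thesis .
        qed
        ultimately show "z \<in> ball y (radius y)" using d by (simp add: d_def)
      qed
      then have "U \<in> \<U>" using U by (auto simp: \<U>_def)
      moreover have "eventually (\<lambda>n. Y n \<omega> \<in> U) sequentially"
        using topological_tendstoD[OF l topological_basis_open[OF \<B>(2) U(1)] U(2)] .
      then obtain N where "\<And>n. n \<ge> N \<Longrightarrow> Y n \<omega> \<in> U" by (auto simp: eventually_sequentially)
      ultimately show False using elim(2) by (meson le_Suc_eq order_refl)
    qed
    ultimately show ?case using conv D by (simp add: l_def frontier_def interior_open)
  qed
qed

text \<open>The means of the extended barrier along the chain start at \<open>q x\<close> and never
  increase; dominated convergence transfers the bound to the limit point, where the comparison with
  \<open>f\<close> holds.\<close>

lemma limit_expectation_le:
  assumes f: "continuous_on (frontier D) f" and q: "continuous_on (closure D) q" "supersolution D q"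
    and bd: "\<And>w. w \<in> frontier D \<Longrightarrow> \<bar>f w - c\<bar> \<le> e + C * q w" and C: "0 \<le> C"
  shows "\<bar>limit_expectation M D f Y - c\<bar> \<le> e + C * q x"
proof -
  have cpt: "compact (closure D)" "compact (frontier D)" using D by (auto simp: compact_frontier_bounded)
  obtain p B where p: "continuous_on UNIV p" "\<And>z. \<bar>p z\<bar> \<le> B" "\<And>z. z \<in> closure D \<Longrightarrow> p z = q z"
    using bounded_continuous_extension[OF cpt(1) q(1)] by blast
  \<comment> \<open>\<open>f\<close> is controlled only on the frontier; the extension makes
    \<open>F (L \<omega>)\<close> a bounded random variable defined everywhere and equal to the
    integrand off a null event.\<close>
  obtain F B' where F: "continuous_on UNIV F" "\<And>z. \<bar>F z\<bar> \<le> B'" "\<And>z. z \<in> frontier D \<Longrightarrow> F z = f z"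
    using bounded_continuous_extension[OF cpt(2) f] by blast
  have [measurable]: "p \<in> borel_measurable borel" "F \<in> borel_measurable borel"
    using p(1) F(1) by (auto intro: borel_measurable_continuous_onI)
  define L where "L = (\<lambda>\<omega>. lim (\<lambda>n. Y n \<omega>))"
  have L[measurable]: "L \<in> borel_measurable M" unfolding L_def by measurable
  have lim: "AE \<omega> in M. (\<lambda>n. Y n \<omega>) \<longlonglongrightarrow> L \<omega> \<and> L \<omega> \<in> frontier D"
    using Y_converges_AE by eventually_elim (simp add: L_def convergent_LIMSEQ_iff)
  have int: "integrable M (\<lambda>\<omega>. F (L \<omega>))" "integrable M (\<lambda>\<omega>. p (L \<omega>))"
    by (rule integrable_const_bound[of _ B'] integrable_const_bound[of _ B]; simp add: F(2) p(2))+
  have [measurable]: "Measurable.pred M (\<lambda>\<omega>. convergent (\<lambda>n. Y n \<omega>))"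
    unfolding Cauchy_convergent_iff[symmetric] by measurable
  have [measurable]: "frontier D \<in> sets borel" by simp
  have "limit_expectation M D f Y = (\<integral>\<omega>. (if convergent (\<lambda>n. Y n \<omega>) \<and> L \<omega> \<in> frontier D then F (L \<omega>) else 0) \<partial>M)"
    unfolding limit_expectation_def L_def by (intro Bochner_Integration.integral_cong refl) (simp add: F(3))
  also have "\<dots> = (\<integral>\<omega>. F (L \<omega>) \<partial>M)"
  proof (rule integral_cong_AE)
    show "AE \<omega> in M. (if convergent (\<lambda>n. Y n \<omega>) \<and> L \<omega> \<in> frontier D then F (L \<omega>) else 0) = F (L \<omega>)"
      using lim by eventually_elim (auto simp: convergent_def)
  qed measurable
  finally have lexp: "limit_expectation M D f Y = (\<integral>\<omega>. F (L \<omega>) \<partial>M)" .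
  have step: "(\<integral>\<omega>. p (Y n \<omega>) \<partial>M) \<le> q x" for n
  proof (induction n)
    case 0
    have "(\<integral>\<omega>. p (Y 0 \<omega>) \<partial>M) = (\<integral>\<omega>. p x \<partial>M)"
      by (intro Bochner_Integration.integral_cong) (auto simp: Y_0)
    then show ?case using p(3)[OF subsetD[OF closure_subset x]] by (simp add: prob_space)
  next
    case (Suc n)
    have "supersolution D p"
      by (rule supersolution_cong[OF D(3) _ q(2)]) (simp add: p(3) subsetD[OF closure_subset])
    from Y_supersolution[OF this p(1,2), of "\<lambda>_. 1" n 1] Suc show ?case by simp
  qed
  have "(\<lambda>n. \<integral>\<omega>. p (Y n \<omega>) \<partial>M) \<longlonglongrightarrow> (\<integral>\<omega>. p (L \<omega>) \<partial>M)"
    by (rule tendsto_expectation[OF _ _ _ p(1,2)]) (use lim in auto)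
  then have pL: "(\<integral>\<omega>. p (L \<omega>) \<partial>M) \<le> q x" using step by (intro LIMSEQ_le_const2) auto
  have "\<bar>limit_expectation M D f Y - c\<bar> = \<bar>\<integral>\<omega>. F (L \<omega>) - c \<partial>M\<bar>"
    unfolding lexp using int by (simp add: prob_space)
  also have "\<dots> \<le> (\<integral>\<omega>. \<bar>F (L \<omega>) - c\<bar> \<partial>M)" by (rule integral_abs_bound)
  also have "\<dots> \<le> (\<integral>\<omega>. e + C * p (L \<omega>) \<partial>M)"
  proof (rule integral_mono_AE)
    show "AE \<omega> in M. \<bar>F (L \<omega>) - c\<bar> \<le> e + C * p (L \<omega>)"
      using lim
    proof eventually_elim
      case (elim \<omega>)
      then have "L \<omega> \<in> closure D" by (simp add: frontier_def)
      then show ?case using bd[of "L \<omega>"] elim by (simp add: F(3) p(3))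
    qed
  qed (use int in auto)
  also have "\<dots> = e + C * (\<integral>\<omega>. p (L \<omega>) \<partial>M)" using int by (simp add: prob_space)
  also have "\<dots> \<le> e + C * q x" using pL C by (simp add: mult_left_mono)
  finally show ?thesis .
qed

end

end

section \<open>Regularity of a boundary point with a barrier\<close>

theorem proposition3p5:
  fixes a \<sigma> \<theta> :: real
    and b v :: "'a::euclidean_space"
    and D :: "'a set"
    and f :: "'a \<Rightarrow> real"
    and M :: "'w measure"
    and W :: "real \<Rightarrow> 'w \<Rightarrow> 'a"
    and Y :: "'a \<Rightarrow> nat \<Rightarrow> 'w \<Rightarrow> 'a"
  assumes "0 < a" and "\<sigma> = sqrt (2 * a)"
    and "0 < \<theta>" and "\<theta> \<le> 1"
    and "D \<noteq> {}" and "bounded D" and "open D"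
    and "continuous_on (frontier D) f"
    and "standard_brownian_motion M W"
    and "\<And>x. x \<in> D \<Longrightarrow> markov_chain_from M (transition_law M b \<sigma> W \<theta> D) x (Y x)"
    and "v \<in> frontier D"
    and "\<exists>q. barrier_at a b D v q"
  shows "regular_point M Y D f v"
proof -
  interpret exit_kernel M W a \<sigma> b \<theta> D
    using assms by unfold_locales auto
  obtain q where qc: "continuous_on (closure D) q" and qh: "harmonic_in a b D q"
    and qv: "q v = 0" and qpos: "\<And>z. z \<in> closure D - {v} \<Longrightarrow> 0 < q z"
    using assms(12) by (auto simp: barrier_at_def)
  have sup: "supersolution D q"
    using qh unfolding harmonic_in_def supersolution_def by (metis order_refl)
  have vD: "v \<in> closure D" using assms(11) by (simp add: frontier_def)
  have fsub: "frontier D \<subseteq> closure D" by (auto simp: frontier_def)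
  have "((\<lambda>x. limit_expectation M D f (Y x)) \<longlongrightarrow> f v) (at v within D)"
  proof (rule tendstoI)
    fix e :: real assume e: "0 < e"
    \<comment> \<open>Half of \<open>e\<close> is spent on the variation of \<open>f\<close> near
      \<open>v\<close>. The constant \<open>C\<close> may be huge, but it is fixed before
      \<open>x\<close> approaches \<open>v\<close>, so \<open>C * q x\<close> takes up less than the
      other half.\<close>
    obtain C where C: "0 \<le> C" "\<And>w. w \<in> frontier D \<Longrightarrow> \<bar>f w - f v\<bar> \<le> e / 2 + C * q w"
    proof (rule abs_diff_le_barrier[of "frontier D" v f q "e / 2"])
      show "continuous_on (frontier D) q" using qc fsub by (rule continuous_on_subset)
      show "0 < q w" if "w \<in> frontier D" "w \<noteq> v" for w using that fsub qpos by auto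
    qed (use assms qv e in \<open>auto simp: compact_frontier_bounded\<close>)
    have "(q \<longlongrightarrow> q v) (at v within D)"
      using qc vD closure_subset by (metis continuous_on_def tendsto_within_subset)
    then have "((\<lambda>x. e / 2 + C * q x) \<longlongrightarrow> e / 2 + C * q v) (at v within D)"
      by (intro tendsto_intros)
    then have "eventually (\<lambda>x. e / 2 + C * q x < e) (at v within D)"
      by (rule order_tendstoD) (use e qv in simp)
    moreover have "eventually (\<lambda>x. x \<in> D) (at v within D)"
      by (simp add: eventually_at_filter)
    ultimately show "eventually (\<lambda>x. dist (limit_expectation M D f (Y x)) (f v) < e) (at v within D)"
    proof eventually_elim
      case (elim x)
      then show ?case
        using limit_expectation_le[OF elim(2) assms(10)[OF elim(2)] assms(8) qc sup C(2,1)]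
        by (simp add: dist_real_def)
    qed
  qed
  then show ?thesis using assms(11) by (simp add: regular_point_def)
qed

end
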